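(* (i) For a graph $G$ with $n$ vertices and $m$ edges, $$0\le I_I^1(G)\le 1-\frac1n.$$ The left equality holds if and only if $m\le 1$, whereas the right equality holds if and only if $m=0$. (ii) Let $T$ be a tree of order $n$. Then $$I_I^1(S_n)\le I_I^1(T)\le I_I^1(P_n),$$ where $S_n$ and $P_n$ denote the star and the path of order $n$, respectively.
   Context: For a graph $G$ with vertices $v_1,\dots,v_n$ and edges $e_1,\dots,e_m$, the incidence matrix $I(G)$ is the $n\times m$ matrix with $(i,j)$-entry $1$ if $v_i$ is incident with $e_j$ and $0$ otherwise. Let $q_1,\dots,q_n$ be the eigenvalues of $I(G)I(G)^T$; the singular values of $I(G)$ are taken to be the $n$ numbers $\sqrt{q_1},\dots,\sqrt{q_n}$. Put $p_i=\sqrt{q_i}/\sum_{j=1}^n\sqrt{q_j}$. The generalized graph entropy $I_I^1(G)$ is $I_I^1(G)=\sum_{i=1}^n p_i(1-p_i)$.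
   Formalization: For m=0 and n≥2 the p_i are 0/0 and the two equality claims contradict each other; the formal version gives edgeless graphs entropy 0, states the right equality criterion only for m>0 or n=1, and for all graphs with denominators cleared. *)

theory Defs
  imports "Jordan_Normal_Form.Char_Poly"
begin

text \<open>
  A graph is given by a list of its vertices \<open>v\<^sub>1, \<dots>, v\<^sub>n\<close> and a list of its edges
  \<open>e\<^sub>1, \<dots>, e\<^sub>m\<close>, an edge being the two-element set of its ends.
  The null graph satisfies this predicate; nonemptiness is required separately.
\<close>

definition simple_graph :: "'a list \<Rightarrow> 'a set list \<Rightarrow> bool" where
  "simple_graph vs es \<longleftrightarrow>
     distinct vs \<and> distinct es \<and> (\<forall>e\<in>set es. e \<subseteq> set vs \<and> card e = 2)"

definition connected_graph :: "'a list \<Rightarrow> 'a set list \<Rightarrow> bool" where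
  "connected_graph vs es \<longleftrightarrow>
     (\<forall>u\<in>set vs. \<forall>v\<in>set vs. (u, v) \<in> {(x, y). {x, y} \<in> set es}\<^sup>*)"

definition is_cycle :: "'a set list \<Rightarrow> 'a list \<Rightarrow> bool" where
  "is_cycle es c \<longleftrightarrow> 3 \<le> length c \<and> distinct c \<and>
     (\<forall>i<length c. {c ! i, c ! (Suc i mod length c)} \<in> set es)"

definition is_tree :: "'a list \<Rightarrow> 'a set list \<Rightarrow> bool" where
  "is_tree vs es \<longleftrightarrow> simple_graph vs es \<and> vs \<noteq> [] \<and> connected_graph vs es \<and>
     (\<nexists>c. is_cycle es c)"

definition star_edges :: "nat \<Rightarrow> nat set list" where
  "star_edges n = map (\<lambda>i. {0, i}) [1..<n]"

definition path_edges :: "nat \<Rightarrow> nat set list" where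
  "path_edges n = map (\<lambda>i. {i, Suc i}) [0..<n - 1]"

definition incidence_mat :: "'a list \<Rightarrow> 'a set list \<Rightarrow> real mat" where
  "incidence_mat vs es =
     mat (length vs) (length es) (\<lambda>(i, j). if vs ! i \<in> es ! j then 1 else 0)"

text \<open>
  The eigenvalues of \<open>I(G) I(G)\<^sup>T\<close>, repeated according to multiplicity. The matrix is real,
  symmetric and positive semidefinite, so its characteristic polynomial splits over the reals,
  the multiset has exactly \<open>n\<close> elements, and none of them is negative.
\<close>

definition incidence_eigenvalues :: "'a list \<Rightarrow> 'a set list \<Rightarrow> real multiset" where
  "incidence_eigenvalues vs es =
     proots (char_poly (incidence_mat vs es * transpose_mat (incidence_mat vs es)))"

definition incidence_singular_values :: "'a list \<Rightarrow> 'a set list \<Rightarrow> real multiset" where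
  "incidence_singular_values vs es = image_mset sqrt (incidence_eigenvalues vs es)"

text \<open>
  For an edgeless graph all singular values vanish, and division by zero makes every
  \<open>p\<^sub>i\<close>, and hence the entropy, equal to \<open>0\<close>.
\<close>

definition graph_entropy :: "'a list \<Rightarrow> 'a set list \<Rightarrow> real" where
  "graph_entropy vs es =
     (let \<sigma> = incidence_singular_values vs es;
          p = (\<lambda>s. s / sum_mset \<sigma>)
      in \<Sum>s\<in>#\<sigma>. p s * (1 - p s))"

end

theory Submission
  imports Defs
    "Jordan_Normal_Form.Schur_Decomposition"
    "HOL-Real_Asymp.Real_Asymp"
    "HOL-Analysis.Convex"
begin

text \<open>
  Let \<open>q\<^sub>1, \<dots>, q\<^sub>n \<ge> 0\<close> be the eigenvalues of \<open>Q = I(G) I(G)\<^sup>T\<close> and \<open>S = \<Sum> sqrt q\<^sub>i\<close>. The trace of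
  \<open>Q\<close> counts every edge twice, so \<open>\<Sum> q\<^sub>i = 2 m\<close> and the entropy of a graph with an edge is
  \<open>1 - 2 m / S\<^sup>2\<close>. Everything is thus a question about \<open>S\<close>.

  For the first part, \<open>2 m \<le> S\<^sup>2 \<le> 2 m n\<close> bounds the entropy. Equality on the left means that at
  most one eigenvalue is nonzero, that is \<open>(\<Sum> q\<^sub>i)\<^sup>2 = \<Sum> q\<^sub>i\<^sup>2\<close>; equality on the right means that all
  eigenvalues agree, that is \<open>(\<Sum> q\<^sub>i)\<^sup>2 = n \<Sum> q\<^sub>i\<^sup>2\<close>. Both conditions are read off from the entries of
  \<open>Q\<close>, because \<open>\<Sum> q\<^sub>i\<^sup>2\<close> is the sum of the squared entries: the first holds exactly if \<open>m \<le> 1\<close>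
  (\<open>edge_intersection_sum_eq_iff\<close>), and the second fails as soon as \<open>Q\<close> has a nonzero entry off the
  diagonal, hence as soon as there is an edge (\<open>trace_square_less_card_frobenius\<close>).

  For the second part, all trees on \<open>n\<close> vertices have the same \<open>m = n - 1\<close>, so it remains to compare
  \<open>S\<close>. A logarithmic integral in the manner of Coulson turns a pointwise comparison of
  \<open>\<Prod> (1 + t q\<^sub>i) = det (1 + t Q)\<close> for \<open>t > 0\<close> into a comparison of \<open>S\<close> (\<open>sum_sqrt_mono_of_prod_le\<close>).
  For a tree \<open>T\<close> this determinant is the generating function \<open>\<Sum>\<^sub>k m\<^sub>k t\<^sup>k\<close> of the numbers \<open>m\<^sub>k\<close> of
  \<open>k\<close>-matchings of the subdivision of \<open>T\<close>, the graph that has the vertices and the edges of \<open>T\<close> as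
  its vertices and incidence as adjacency. It satisfies the leaf recursion
  \<open>M(X) = M(X - u) + t M(X - u - v)\<close> for a leaf \<open>u\<close> with neighbour \<open>v\<close>. Among all forests
  on a given number of vertices the path loses the least in this recursion, and the subdivision of a
  path is a path; among subdivisions of trees the star has the smallest sum. Both bounds are
  inductions along the construction of a tree by attaching leaves (\<open>grown_tree_matching_le_path\<close>,
  \<open>star_le_grown_tree_matching\<close>).
\<close>

section \<open>Spectra of Gram matrices\<close>

definition mtrace :: "'a::comm_ring_1 mat \<Rightarrow> 'a" where
  "mtrace A = (\<Sum>i<dim_row A. A $$ (i, i))"

lemma index_mult_mat_sum:
  assumes "A \<in> carrier_mat n k" "B \<in> carrier_mat k m" "i < n" "j < m"
  shows "(A * B) $$ (i, j) = (\<Sum>l<k. A $$ (i, l) * B $$ (l, j))"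
  using assms by (auto simp: scalar_prod_def atLeast0LessThan)

lemma mtrace_commute:
  assumes "A \<in> carrier_mat n m" "B \<in> carrier_mat m n"
  shows "mtrace (A * B) = mtrace (B * A)"
proof -
  have "mtrace (A * B) = (\<Sum>i<n. \<Sum>l<m. A $$ (i, l) * B $$ (l, i))"
    unfolding mtrace_def using assms by (intro sum.cong) (auto simp: index_mult_mat_sum[OF assms] simp del: index_mult_mat(1))
  also have "\<dots> = (\<Sum>l<m. \<Sum>i<n. B $$ (l, i) * A $$ (i, l))"
    by (subst sum.swap) (simp add: mult.commute)
  also have "\<dots> = mtrace (B * A)"
    unfolding mtrace_def using assms
    by (intro sum.cong) (auto simp: index_mult_mat_sum[OF assms(2,1)] simp del: index_mult_mat(1))
  finally show ?thesis .
qed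

lemma mtrace_similar:
  assumes "similar_mat_wit A B P Q"
  shows "mtrace A = mtrace B"
proof -
  define n where "n = dim_row A"
  have c: "A \<in> carrier_mat n n" "B \<in> carrier_mat n n" "P \<in> carrier_mat n n" "Q \<in> carrier_mat n n"
    and QP: "Q * P = 1\<^sub>m n" and A: "A = P * B * Q"
    using similar_mat_witD[OF n_def assms] by simp_all
  have "mtrace A = mtrace (Q * (P * B))"
    unfolding A using c by (intro mtrace_commute) auto
  also have "Q * (P * B) = (Q * P) * B"
    by (rule assoc_mult_mat[symmetric]) (use c in auto)
  also have "\<dots> = B"
    using c QP by simp
  finally show ?thesis .
qed

lemma mtrace_square_similar:
  fixes A :: "'a::comm_ring_1 mat"
  assumes "similar_mat_wit A B P Q"
  shows "mtrace (A * A) = mtrace (B * B)"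
proof -
  have sq: "M ^\<^sub>m 2 = M * M" if "M \<in> carrier_mat n n" for n and M :: "'a mat"
    using that by (simp add: numeral_2_eq_2)
  have "A ^\<^sub>m 2 = A * A" "B ^\<^sub>m 2 = B * B"
    by (rule sq, rule similar_mat_witD(4,5)[OF refl assms])+
  with mtrace_similar[OF similar_mat_wit_pow[OF assms, of 2]] show ?thesis by simp
qed

lemma upper_triangular_square_diag:
  fixes B :: "'a::comm_ring_1 mat"
  assumes "B \<in> carrier_mat n n" "upper_triangular B" "i < n"
  shows "(B * B) $$ (i, i) = (B $$ (i, i))\<^sup>2"
proof -
  have "(B * B) $$ (i, i) = (\<Sum>l<n. B $$ (i, l) * B $$ (l, i))"
    by (rule index_mult_mat_sum) (use assms(1,3) in auto)
  also have "\<dots> = (\<Sum>l\<in>{i}. B $$ (i, l) * B $$ (l, i))"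
  proof (rule sum.mono_neutral_right)
    show "\<forall>l\<in>{..<n} - {i}. B $$ (i, l) * B $$ (l, i) = 0"
    proof
      fix l assume "l \<in> {..<n} - {i}"
      hence "l < i \<or> i < l" "l < n" by auto
      thus "B $$ (i, l) * B $$ (l, i) = 0"
        using upper_triangularD[OF assms(2), of l i] upper_triangularD[OF assms(2), of i l] assms(1,3)
        by auto
    qed
  qed (use assms(3) in auto)
  finally show ?thesis by (simp add: power2_eq_square)
qed

text \<open>
  If \<open>A A\<^sup>T v = \<mu> v\<close> and \<open>w = A\<^sup>T v\<close>, then pairing with \<open>v\<close> gives \<open>\<mu> \<parallel>v\<parallel>\<^sup>2 = \<parallel>w\<parallel>\<^sup>2\<close>. The eigenvalue is
  taken over the complex numbers, where the characteristic polynomial splits.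
\<close>

lemma eigenvalue_gram_nonneg:
  fixes A :: "real mat"
  assumes A: "A \<in> carrier_mat n m"
    and ev: "eigenvalue (map_mat complex_of_real (A * transpose_mat A)) \<mu>"
  shows "\<mu> \<in> \<real> \<and> 0 \<le> Re \<mu>"
proof -
  let ?Q = "map_mat complex_of_real (A * transpose_mat A)"
  obtain v where v: "v \<in> carrier_vec n" "v \<noteq> 0\<^sub>v n" "?Q *\<^sub>v v = \<mu> \<cdot>\<^sub>v v"
    using ev A unfolding eigenvalue_def eigenvector_def by auto
  define w where "w k = (\<Sum>j<n. of_real (A $$ (j, k)) * v $ j)" for k
  have Qv: "(?Q *\<^sub>v v) $ i = (\<Sum>k<m. of_real (A $$ (i, k)) * w k)" if i: "i < n" for i
  proof -
    have "(?Q *\<^sub>v v) $ i = (\<Sum>j<n. of_real ((A * transpose_mat A) $$ (i, j)) * v $ j)"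
      using i A v(1) by (auto simp: scalar_prod_def atLeast0LessThan)
    also have "\<dots> = (\<Sum>j<n. \<Sum>k<m. of_real (A $$ (i, k)) * (of_real (A $$ (j, k)) * v $ j))"
    proof (rule sum.cong[OF refl])
      fix j assume "j \<in> {..<n}"
      hence "(A * transpose_mat A) $$ (i, j) = (\<Sum>k<m. A $$ (i, k) * A $$ (j, k))"
        using A i by (subst index_mult_mat_sum[of _ n m _ n]) auto
      thus "of_real ((A * transpose_mat A) $$ (i, j)) * v $ j =
        (\<Sum>k<m. of_real (A $$ (i, k)) * (of_real (A $$ (j, k)) * v $ j))"
        by (simp add: sum_distrib_right mult.assoc)
    qed
    also have "\<dots> = (\<Sum>k<m. of_real (A $$ (i, k)) * w k)"
      unfolding w_def by (subst sum.swap) (simp add: sum_distrib_left)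
    finally show ?thesis .
  qed
  have "\<mu> * (\<Sum>i<n. v $ i * cnj (v $ i)) = (\<Sum>i<n. (?Q *\<^sub>v v) $ i * cnj (v $ i))"
    unfolding v(3) using v(1) by (simp add: sum_distrib_left mult.assoc)
  also have "\<dots> = (\<Sum>i<n. \<Sum>k<m. w k * cnj (of_real (A $$ (i, k)) * v $ i))"
    by (intro sum.cong refl) (simp add: Qv sum_distrib_left sum_distrib_right mult_ac)
  also have "\<dots> = (\<Sum>k<m. w k * cnj (w k))"
    by (subst sum.swap) (simp add: w_def sum_distrib_left cnj_sum)
  finally have eq: "\<mu> * of_real (\<Sum>i<n. (cmod (v $ i))\<^sup>2) = of_real (\<Sum>k<m. (cmod (w k))\<^sup>2)"
    by (simp add: complex_norm_square del: of_real_power)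
  obtain i where i: "i < n" "v $ i \<noteq> 0"
  proof (rule ccontr)
    assume "\<not> thesis"
    hence "v = 0\<^sub>v n" using that v(1) by (intro eq_vecI) auto
    with v(2) show False ..
  qed
  have pos: "(\<Sum>i<n. (cmod (v $ i))\<^sup>2) > 0"
    by (rule sum_pos2[of _ i]) (use i in auto)
  have "\<mu> = of_real ((\<Sum>k<m. (cmod (w k))\<^sup>2) / (\<Sum>i<n. (cmod (v $ i))\<^sup>2))"
    unfolding of_real_divide
  proof (subst nonzero_eq_divide_eq)
    show "complex_of_real (\<Sum>i<n. (cmod (v $ i))\<^sup>2) \<noteq> 0"
      using pos by (simp only: of_real_eq_0_iff less_numeral_extra)
  qed (rule eq)
  moreover have "0 \<le> (\<Sum>k<m. (cmod (w k))\<^sup>2) / (\<Sum>i<n. (cmod (v $ i))\<^sup>2)"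
    using pos by (simp add: sum_nonneg)
  ultimately show ?thesis by (simp only: Reals_of_real Re_complex_of_real simp_thms)
qed

text \<open>
  The complex roots are real by the previous lemma, so the factorization descends along the
  injective map from real to complex polynomials.
\<close>

lemma char_poly_gram_splits:
  fixes A :: "real mat"
  assumes A: "A \<in> carrier_mat n m"
  shows "\<exists>qs. char_poly (A * transpose_mat A) = (\<Prod>q\<leftarrow>qs. [:- q, 1:]) \<and>
           length qs = n \<and> (\<forall>q\<in>set qs. 0 \<le> q)"
proof -
  let ?Q = "A * transpose_mat A"
  let ?C = "map_mat complex_of_real ?Q"
  have Q: "?Q \<in> carrier_mat n n" using A by auto
  hence C: "?C \<in> carrier_mat n n" by auto
  obtain as where as: "char_poly ?C = (\<Prod>a\<leftarrow>as. [:- a, 1:])" "length as = n"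
    using char_poly_factorized[OF C] by auto
  define qs where "qs = map Re as"
  have real: "a \<in> \<real> \<and> 0 \<le> Re a" if "a \<in> set as" for a
  proof -
    have "poly (char_poly ?C) a = 0"
      unfolding as(1) poly_prod_list using that by (auto simp: prod_list_zero_iff)
    thus ?thesis
      using eigenvalue_gram_nonneg[OF A] eigenvalue_root_char_poly[OF C] by blast
  qed
  interpret h: map_poly_inj_comm_ring_hom complex_of_real ..
  have "map_poly complex_of_real (char_poly ?Q) = (\<Prod>a\<leftarrow>as. [:- a, 1:])"
    using of_real_hom.char_poly_hom[OF Q, where ?'a = complex] as(1) by simp
  also have "\<dots> = map_poly complex_of_real (\<Prod>q\<leftarrow>qs. [:- q, 1:])"
    using real unfolding qs_def
    by (induction as)
      (auto simp: h.hom_mult of_real_hom.map_poly_pCons_hom simp del: mult_pCons_left)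
  finally have "char_poly ?Q = (\<Prod>q\<leftarrow>qs. [:- q, 1:])" by simp
  thus ?thesis using as(2) real by (intro exI[of _ qs]) (auto simp: qs_def)
qed

text \<open>
  A real Schur form of \<open>Q\<close> carries the eigenvalues on its diagonal; similarity preserves the traces of
  \<open>Q\<close> and \<open>Q\<^sup>2\<close>, and by symmetry the latter is the sum of the squared entries of \<open>Q\<close>.
\<close>

lemma gram_spectrum:
  fixes A :: "real mat"
  assumes A: "A \<in> carrier_mat n m"
  defines "Q \<equiv> A * transpose_mat A"
  obtains q :: "nat \<Rightarrow> real" where
    "\<And>i. 0 \<le> q i"
    "char_poly Q = (\<Prod>i<n. [:- q i, 1:])"
    "(\<Sum>i<n. q i) = (\<Sum>i<n. Q $$ (i, i))"
    "(\<Sum>i<n. (q i)\<^sup>2) = (\<Sum>i<n. \<Sum>j<n. (Q $$ (i, j))\<^sup>2)"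
proof -
  obtain qs where cp: "char_poly Q = (\<Prod>q\<leftarrow>qs. [:- q, 1:])"
    and len: "length qs = n" and nonneg: "\<forall>q\<in>set qs. 0 \<le> q"
    using char_poly_gram_splits[OF A] unfolding Q_def by blast
  have Q: "Q \<in> carrier_mat n n" using A by (auto simp: Q_def)
  obtain B P R where BPR: "schur_decomposition Q qs = (B, P, R)"
    by (metis prod_cases3)
  have wit: "similar_mat_wit Q B P R" and ut: "upper_triangular B" and diag: "diag_mat B = qs"
    using schur_decomposition[OF Q cp BPR] by simp_all
  have B: "B \<in> carrier_mat n n" using similar_mat_witD2[OF Q wit] by simp
  \<comment> \<open>The value 0 beyond the list makes nonnegativity hold at every index.\<close>
  define q where "q i = (if i < n then qs ! i else 0)" for i
  have qB: "q i = B $$ (i, i)" if "i < n" for i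
  proof -
    have "B $$ (i, i) = diag_mat B ! i" using that B by (simp add: diag_mat_def)
    thus ?thesis using that by (simp add: diag q_def)
  qed
  show thesis
  proof (rule that[of q])
    show "0 \<le> q i" for i using nonneg len by (auto simp: q_def)
    show "char_poly Q = (\<Prod>i<n. [:- q i, 1:])"
      unfolding cp prod.list_conv_set_nth using len by (simp add: q_def atLeast0LessThan)
    have "(\<Sum>i<n. q i) = mtrace B" unfolding mtrace_def using B qB by auto
    also have "\<dots> = mtrace Q" using mtrace_similar[OF wit] by simp
    finally show "(\<Sum>i<n. q i) = (\<Sum>i<n. Q $$ (i, i))" using Q by (auto simp: mtrace_def)
    have sym: "Q $$ (i, j) = Q $$ (j, i)" if "i < n" "j < n" for i j
      using that A unfolding Q_def
      by (subst (1 2) index_mult_mat_sum[of _ n m _ n]) (auto simp: mult.commute)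
    have "(\<Sum>i<n. (q i)\<^sup>2) = mtrace (B * B)"
      unfolding mtrace_def using B
      by (intro sum.cong) (simp_all add: upper_triangular_square_diag[OF B ut] qB del: index_mult_mat(1))
    also have "\<dots> = mtrace (Q * Q)" using mtrace_square_similar[OF wit] by simp
    also have "\<dots> = (\<Sum>i<n. \<Sum>j<n. Q $$ (i, j) * Q $$ (j, i))"
      unfolding mtrace_def using Q by (intro sum.cong) (auto simp: index_mult_mat_sum[OF Q Q] simp del: index_mult_mat(1))
    also have "\<dots> = (\<Sum>i<n. \<Sum>j<n. (Q $$ (i, j))\<^sup>2)"
      by (intro sum.cong refl) (auto simp: power2_eq_square sym)
    finally show "(\<Sum>i<n. (q i)\<^sup>2) = (\<Sum>i<n. \<Sum>j<n. (Q $$ (i, j))\<^sup>2)" .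
  qed
qed

text \<open>
  The characteristic polynomial evaluated at \<open>- 1 / t\<close>, scaled by \<open>(- t)\<^sup>n\<close>.
\<close>

lemma det_one_plus_smult:
  fixes Q :: "real mat"
  assumes Q: "Q \<in> carrier_mat n n" and cp: "char_poly Q = (\<Prod>i<n. [:- q i, 1:])" and t: "0 < t"
  shows "det (1\<^sub>m n + t \<cdot>\<^sub>m Q) = (\<Prod>i<n. 1 + t * q i)"
proof -
  let ?M = "- char_matrix Q (- 1 / t)"
  have "(\<Prod>i<n. 1 + t * q i) = (\<Prod>i<n. - t * (- 1 / t - q i))"
    using t by (intro prod.cong) (auto simp: field_simps)
  also have "\<dots> = (\<Prod>i<n. - t) * (\<Prod>i<n. - 1 / t - q i)"
    by (rule prod.distrib)
  also have "\<dots> = (- t) ^ n * poly (char_poly Q) (- 1 / t)"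
  proof -
    have "poly (char_poly Q) (- 1 / t) = (\<Prod>i<n. - 1 / t - q i)"
      unfolding cp poly_prod by (rule prod.cong) auto
    thus ?thesis by simp
  qed
  also have "\<dots> = det (- t \<cdot>\<^sub>m ?M)"
    using char_poly_matrix[OF Q] Q by (simp add: char_matrix_def)
  also have "- t \<cdot>\<^sub>m ?M = 1\<^sub>m n + t \<cdot>\<^sub>m Q"
    using Q t by (intro eq_matI) (auto simp: char_matrix_def field_simps)
  finally show ?thesis by simp
qed

section \<open>Spectrum of the incidence matrix\<close>

text \<open>
  For nonnegative numbers \<open>x\<^sub>i\<close>, the equation \<open>(\<Sum> x\<^sub>i)\<^sup>2 = \<Sum> x\<^sub>i\<^sup>2\<close> says that \<open>\<Sum> x\<^sub>i (s - x\<^sub>i)\<close> vanishes with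
  \<open>s = \<Sum> x\<^sub>j\<close>, hence that at most one \<open>x\<^sub>i\<close> is nonzero. This condition is the same for the \<open>q\<^sub>i\<close> and
  for their square roots, which moves the question from singular values to eigenvalues.
\<close>

lemma sum_square_eq_iff_sum_sqrt_square_eq:
  fixes q :: "'a \<Rightarrow> real"
  assumes fin: "finite A" and nonneg: "\<And>i. i \<in> A \<Longrightarrow> 0 \<le> q i"
  shows "(\<Sum>i\<in>A. sqrt (q i))\<^sup>2 = (\<Sum>i\<in>A. q i) \<longleftrightarrow> (\<Sum>i\<in>A. q i)\<^sup>2 = (\<Sum>i\<in>A. (q i)\<^sup>2)"
proof -
  have conc: "(\<Sum>i\<in>A. x i)\<^sup>2 = (\<Sum>i\<in>A. (x i)\<^sup>2) \<longleftrightarrow> (\<forall>i\<in>A. x i = 0 \<or> x i = (\<Sum>j\<in>A. x j))"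
    if x: "\<And>i. i \<in> A \<Longrightarrow> 0 \<le> x i" for x :: "'a \<Rightarrow> real"
  proof -
    have "(\<Sum>i\<in>A. x i)\<^sup>2 - (\<Sum>i\<in>A. (x i)\<^sup>2) = (\<Sum>i\<in>A. x i * ((\<Sum>j\<in>A. x j) - x i))"
      by (simp add: power2_eq_square right_diff_distrib sum_subtractf sum_distrib_right)
    moreover have "(\<Sum>i\<in>A. x i * ((\<Sum>j\<in>A. x j) - x i)) = 0 \<longleftrightarrow>
        (\<forall>i\<in>A. x i * ((\<Sum>j\<in>A. x j) - x i) = 0)"
      using fin x by (intro sum_nonneg_eq_0_iff) (auto intro!: mult_nonneg_nonneg member_le_sum)
    ultimately show ?thesis by auto
  qed
  define S where "S = (\<Sum>i\<in>A. sqrt (q i))"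
  define T where "T = (\<Sum>i\<in>A. q i)"
  have S: "S\<^sup>2 = T \<longleftrightarrow> (\<forall>i\<in>A. sqrt (q i) = 0 \<or> sqrt (q i) = S)"
    using conc[of "\<lambda>i. sqrt (q i)"] nonneg by (simp add: S_def T_def)
  have T: "T\<^sup>2 = (\<Sum>i\<in>A. (q i)\<^sup>2) \<longleftrightarrow> (\<forall>i\<in>A. q i = 0 \<or> q i = T)"
    using conc[of q] nonneg by (simp add: T_def)
  have T0: "0 \<le> T" and S0: "0 \<le> S" unfolding T_def S_def using nonneg by (auto intro: sum_nonneg)
  have "S\<^sup>2 = T" if *: "\<forall>i\<in>A. q i = 0 \<or> q i = T"
  proof -
    have "sqrt T * S = (\<Sum>i\<in>A. q i)"
      unfolding S_def sum_distrib_left using * T0 by (intro sum.cong) auto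
    hence "sqrt T * S = sqrt T * sqrt T" using T0 by (simp add: T_def)
    show ?thesis
    proof (cases "T = 0")
      case True
      hence "\<forall>i\<in>A. q i = 0" using * by auto
      thus ?thesis using True by (simp add: S_def)
    next
      case False
      with \<open>sqrt T * S = sqrt T * sqrt T\<close> have "S = sqrt T"
        by (metis mult_cancel_left real_sqrt_eq_zero_cancel_iff)
      thus ?thesis using T0 by simp
    qed
  qed
  moreover have "\<forall>i\<in>A. q i = 0 \<or> q i = T" if "S\<^sup>2 = T"
  proof
    fix i assume i: "i \<in> A"
    with that S have "sqrt (q i) = 0 \<or> sqrt (q i) = S" by blast
    thus "q i = 0 \<or> q i = T"
      using that nonneg[OF i] by (metis real_sqrt_eq_zero_cancel_iff real_sqrt_pow2)
  qed
  ultimately show ?thesis unfolding S_def[symmetric] T_def[symmetric] T by blast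
qed

text \<open>
  Equality in the Cauchy-Schwarz inequality: the variance of the \<open>x i\<close> vanishes.
\<close>

lemma equal_of_card_sum_squares:
  fixes x :: "'a \<Rightarrow> real"
  assumes fin: "finite A" and eq: "real (card A) * (\<Sum>i\<in>A. (x i)\<^sup>2) = (\<Sum>i\<in>A. x i)\<^sup>2" and i: "i \<in> A"
  shows "x i = (\<Sum>j\<in>A. x j) / card A"
proof -
  define c where "c = (\<Sum>j\<in>A. x j) / card A"
  have card: "card A \<noteq> 0" using fin i by auto
  have sum: "(\<Sum>j\<in>A. x j) = card A * c" using card by (simp add: c_def)
  have "(\<Sum>j\<in>A. (x j - c)\<^sup>2) = (\<Sum>j\<in>A. (x j)\<^sup>2 - 2 * c * x j + c\<^sup>2)"
    by (simp add: power2_diff mult_ac add_diff_eq diff_add_eq)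
  also have "\<dots> = (\<Sum>j\<in>A. (x j)\<^sup>2) - 2 * c * (\<Sum>j\<in>A. x j) + card A * c\<^sup>2"
    by (simp add: sum.distrib sum_subtractf flip: sum_distrib_left)
  also have "\<dots> = 0"
  proof -
    have "real (card A) * (\<Sum>i\<in>A. (x i)\<^sup>2) = real (card A) * (card A * c\<^sup>2)"
      unfolding eq sum by (simp only: power2_eq_square mult_ac)
    hence "(\<Sum>i\<in>A. (x i)\<^sup>2) = card A * c\<^sup>2"
      using card by (simp only: mult_cancel_left of_nat_eq_0_iff simp_thms)
    thus ?thesis unfolding sum by (simp add: power2_eq_square)
  qed
  finally have "(\<Sum>j\<in>A. (x j - c)\<^sup>2) = 0" .
  hence "\<forall>j\<in>A. (x j - c)\<^sup>2 = 0" using fin by (simp add: sum_nonneg_eq_0_iff)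
  hence "x i = c" using i by simp
  thus ?thesis unfolding c_def .
qed

lemma sum_over_distinct_list_indices:
  assumes "distinct vs"
  shows "(\<Sum>i<length vs. f (vs ! i)) = (\<Sum>v\<in>set vs. f v)"
  by (rule sum.reindex_bij_betw[OF bij_betw_nth[OF assms refl refl]])

lemma incidence_gram_entry:
  fixes vs :: "'a list"
  assumes "i < length vs" "j < length vs"
  shows "(incidence_mat vs es * transpose_mat (incidence_mat vs es)) $$ (i, j) =
    (\<Sum>k<length es. of_bool (vs ! i \<in> es ! k \<and> vs ! j \<in> es ! k))"
proof -
  let ?A = "incidence_mat vs es"
  have "(?A * transpose_mat ?A) $$ (i, j) =
      (\<Sum>k<length es. ?A $$ (i, k) * transpose_mat ?A $$ (k, j))"
    by (rule index_mult_mat_sum[OF _ _ assms]) (auto simp: incidence_mat_def)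
  also have "\<dots> = (\<Sum>k<length es. of_bool (vs ! i \<in> es ! k \<and> vs ! j \<in> es ! k))"
    by (rule sum.cong) (use assms in \<open>auto simp: incidence_mat_def\<close>)
  finally show ?thesis .
qed

lemma incidence_gram_trace:
  assumes G: "simple_graph vs es"
  shows "(\<Sum>i<length vs. (incidence_mat vs es * transpose_mat (incidence_mat vs es)) $$ (i, i)) =
    2 * real (length es)"
proof -
  have "(\<Sum>i<length vs. (incidence_mat vs es * transpose_mat (incidence_mat vs es)) $$ (i, i)) =
      (\<Sum>k<length es. \<Sum>i<length vs. of_bool (vs ! i \<in> es ! k))"
    by (subst sum.swap) (simp add: incidence_gram_entry)
  also have "\<dots> = (\<Sum>k<length es. 2)"
  proof (rule sum.cong[OF refl])
    fix k assume "k \<in> {..<length es}"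
    hence e: "es ! k \<subseteq> set vs" "card (es ! k) = 2" using G by (auto simp: simple_graph_def)
    have "(\<Sum>i<length vs. of_bool (vs ! i \<in> es ! k)) = (\<Sum>v\<in>set vs. of_bool (v \<in> es ! k) :: real)"
      using G by (intro sum_over_distinct_list_indices) (simp add: simple_graph_def)
    also have "\<dots> = real (card (es ! k))" using e(1) by (simp add: Int_absorb1 Int_absorb2)
    finally show "(\<Sum>i<length vs. of_bool (vs ! i \<in> es ! k)) = (2 :: real)" using e(2) by simp
  qed
  finally show ?thesis by simp
qed

text \<open>
  The matrices \<open>I I\<^sup>T\<close> and \<open>I\<^sup>T I\<close> have the same sum of squared entries, and the entries of the latter
  are the intersection sizes of the edges.
\<close>

lemma incidence_gram_frobenius:
  assumes G: "simple_graph vs es"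
  shows "(\<Sum>i<length vs. \<Sum>j<length vs.
      ((incidence_mat vs es * transpose_mat (incidence_mat vs es)) $$ (i, j))\<^sup>2) =
    (\<Sum>k<length es. \<Sum>l<length es. (real (card (es ! k \<inter> es ! l)))\<^sup>2)"
proof -
  let ?I = "{..<length vs}" and ?J = "{..<length es}"
  have inter: "(\<Sum>i\<in>?I. of_bool (vs ! i \<in> es ! k \<and> vs ! i \<in> es ! l)) = real (card (es ! k \<inter> es ! l))"
    if "k \<in> ?J" for k l
  proof -
    have "es ! k \<subseteq> set vs" using G that by (auto simp: simple_graph_def)
    hence "set vs \<inter> {v. v \<in> es ! k \<and> v \<in> es ! l} = es ! k \<inter> es ! l" by auto
    moreover have "(\<Sum>i\<in>?I. of_bool (vs ! i \<in> es ! k \<and> vs ! i \<in> es ! l)) =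
        (\<Sum>v\<in>set vs. of_bool (v \<in> es ! k \<and> v \<in> es ! l) :: real)"
      using G by (intro sum_over_distinct_list_indices) (simp add: simple_graph_def)
    ultimately show ?thesis by simp
  qed
  have "(\<Sum>i\<in>?I. \<Sum>j\<in>?I. ((incidence_mat vs es * transpose_mat (incidence_mat vs es)) $$ (i, j))\<^sup>2) =
      (\<Sum>i\<in>?I. \<Sum>j\<in>?I. \<Sum>k\<in>?J. \<Sum>l\<in>?J. of_bool (vs ! i \<in> es ! k \<and> vs ! i \<in> es ! l) *
        of_bool (vs ! j \<in> es ! k \<and> vs ! j \<in> es ! l))"
  proof (intro sum.cong refl)
    fix i j assume ij: "i \<in> ?I" "j \<in> ?I"
    have "((incidence_mat vs es * transpose_mat (incidence_mat vs es)) $$ (i, j))\<^sup>2 =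
        (\<Sum>k\<in>?J. \<Sum>l\<in>?J. of_bool (vs ! i \<in> es ! k \<and> vs ! j \<in> es ! k) *
          of_bool (vs ! i \<in> es ! l \<and> vs ! j \<in> es ! l))"
      using ij by (simp only: incidence_gram_entry lessThan_iff power2_eq_square sum_product)
    thus "((incidence_mat vs es * transpose_mat (incidence_mat vs es)) $$ (i, j))\<^sup>2 =
        (\<Sum>k\<in>?J. \<Sum>l\<in>?J. of_bool (vs ! i \<in> es ! k \<and> vs ! i \<in> es ! l) *
          of_bool (vs ! j \<in> es ! k \<and> vs ! j \<in> es ! l))"
      by (simp only: of_bool_conj mult_ac)
  qed
  also have "\<dots> = (\<Sum>k\<in>?J. \<Sum>l\<in>?J. \<Sum>i\<in>?I. \<Sum>j\<in>?I. of_bool (vs ! i \<in> es ! k \<and> vs ! i \<in> es ! l) *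
        of_bool (vs ! j \<in> es ! k \<and> vs ! j \<in> es ! l))"
    by (simp only: sum.swap[where A = ?I and B = ?J])
  also have "\<dots> = (\<Sum>k\<in>?J. \<Sum>l\<in>?J. (real (card (es ! k \<inter> es ! l)))\<^sup>2)"
    by (intro sum.cong refl) (simp only: sum_product[symmetric] inter power2_eq_square)
  finally show ?thesis .
qed

text \<open>
  An edge meets itself in two vertices and any other edge in at most one, so the sum is at most
  \<open>4 m + m (m - 1)\<close>, which is smaller than \<open>4 m\<^sup>2\<close> once \<open>m \<ge> 2\<close>.
\<close>

lemma edge_intersection_sum_eq_iff:
  assumes G: "simple_graph vs es"
  shows "(2 * real (length es))\<^sup>2 =
      (\<Sum>k<length es. \<Sum>l<length es. (real (card (es ! k \<inter> es ! l)))\<^sup>2) \<longleftrightarrow> length es \<le> 1"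
proof (cases "length es \<le> 1")
  case True
  show ?thesis
  proof (cases es)
    case (Cons e es')
    hence "es = [e]" using True by simp
    thus ?thesis using G by (simp add: simple_graph_def)
  qed simp
next
  case False
  let ?m = "length es"
  have m: "2 \<le> ?m" using False by simp
  have entry: "(real (card (es ! k \<inter> es ! l)))\<^sup>2 \<le> 1 + (if k = l then 3 else 0)"
    if kl: "k < ?m" "l < ?m" for k l
  proof (cases "k = l")
    case True
    have "card (es ! l) = 2" using G kl by (auto simp: simple_graph_def)
    thus ?thesis using True by simp
  next
    case False
    have c: "card (es ! k) = 2" "card (es ! l) = 2" and ne: "es ! k \<noteq> es ! l"
      using G kl False by (auto simp: simple_graph_def nth_eq_iff_index_eq)
    have fin: "finite (es ! k)" "finite (es ! l)" using c by (auto intro: card_ge_0_finite)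
    have "es ! k \<inter> es ! l \<noteq> es ! k"
      using c ne fin by (metis card_subset_eq inf.cobounded2)
    hence "card (es ! k \<inter> es ! l) < card (es ! k)"
      using fin by (intro psubset_card_mono) auto
    hence "real (card (es ! k \<inter> es ! l)) \<le> 1" using c by simp
    hence "(real (card (es ! k \<inter> es ! l)))\<^sup>2 \<le> 1" by (simp add: power_le_one)
    thus ?thesis using False by simp
  qed
  have "(\<Sum>k<?m. \<Sum>l<?m. (real (card (es ! k \<inter> es ! l)))\<^sup>2) \<le>
      (\<Sum>k<?m. \<Sum>l<?m. 1 + (if k = l then 3 else 0))"
    by (intro sum_mono) (use entry in auto)
  also have "\<dots> = real ?m * real ?m + 3 * real ?m"
    by (simp add: sum.distrib distrib_left)
  also have "\<dots> < (2 * real ?m)\<^sup>2"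
  proof -
    have "2 * real ?m \<le> real ?m * real ?m" using m by (intro mult_right_mono) auto
    moreover have "0 < real ?m" using m by linarith
    ultimately show ?thesis unfolding power2_eq_square by linarith
  qed
  finally show ?thesis using False by simp
qed

text \<open>
  Cauchy-Schwarz on the diagonal; the off-diagonal entry makes the estimate strict.
\<close>

lemma trace_square_less_card_frobenius:
  fixes Q :: "nat \<Rightarrow> nat \<Rightarrow> real"
  assumes a: "a < n" and b: "b < n" and ab: "a \<noteq> b" "Q a b \<noteq> 0"
  shows "(\<Sum>i<n. Q i i)\<^sup>2 < real n * (\<Sum>i<n. \<Sum>j<n. (Q i j)\<^sup>2)"
proof -
  have "(\<Sum>i<n. Q i i)\<^sup>2 \<le> (\<Sum>i<n. (Q i i)\<^sup>2) * card {..<n}"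
    by (rule sum_squared_le_sum_of_squares)
  also have "\<dots> < (\<Sum>i<n. \<Sum>j<n. (Q i j)\<^sup>2) * card {..<n}"
  proof (rule mult_strict_right_mono)
    show "(\<Sum>i<n. (Q i i)\<^sup>2) < (\<Sum>i<n. \<Sum>j<n. (Q i j)\<^sup>2)"
    proof (rule sum_strict_mono_ex1)
      show "\<forall>i\<in>{..<n}. (Q i i)\<^sup>2 \<le> (\<Sum>j<n. (Q i j)\<^sup>2)"
        by (auto intro!: member_le_sum[of _ _ "\<lambda>j. (Q _ j)\<^sup>2"])
      have "(\<Sum>j\<in>{a, b}. (Q a j)\<^sup>2) \<le> (\<Sum>j<n. (Q a j)\<^sup>2)"
        using a b by (intro sum_mono2) auto
      hence "(Q a a)\<^sup>2 + (Q a b)\<^sup>2 \<le> (\<Sum>j<n. (Q a j)\<^sup>2)" using ab(1) by simp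
      moreover have "0 < (Q a b)\<^sup>2" using ab by simp
      ultimately have "(Q a a)\<^sup>2 < (\<Sum>j<n. (Q a j)\<^sup>2)" by linarith
      thus "\<exists>i\<in>{..<n}. (Q i i)\<^sup>2 < (\<Sum>j<n. (Q i j)\<^sup>2)" using a by auto
    qed simp
  qed (use a in simp)
  finally show ?thesis by (simp add: mult.commute)
qed

text \<open>
  All spectral information about a graph that the entropy bounds use: the fourth fact decides whether
  at most one eigenvalue is nonzero, the fifth excludes that all eigenvalues are equal.
\<close>

lemma graph_spectrum:
  fixes vs :: "'a list" and es :: "'a set list"
  assumes G: "simple_graph vs es"
  defines "n \<equiv> length vs" and "m \<equiv> length es" and "A \<equiv> incidence_mat vs es"
  obtains q :: "nat \<Rightarrow> real" where
    "\<And>i. 0 \<le> q i"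
    "incidence_eigenvalues vs es = image_mset q (mset_set {..<n})"
    "(\<Sum>i<n. q i) = 2 * real m"
    "(\<Sum>i<n. q i)\<^sup>2 = (\<Sum>i<n. (q i)\<^sup>2) \<longleftrightarrow> m \<le> 1"
    "0 < m \<Longrightarrow> (\<Sum>i<n. q i)\<^sup>2 < real n * (\<Sum>i<n. (q i)\<^sup>2)"
    "\<And>t. 0 < t \<Longrightarrow> (\<Prod>i<n. 1 + t * q i) = det (1\<^sub>m n + t \<cdot>\<^sub>m (A * transpose_mat A))"
proof -
  have A: "A \<in> carrier_mat n m" by (simp add: A_def incidence_mat_def n_def m_def)
  let ?Q = "A * transpose_mat A"
  have Q: "?Q \<in> carrier_mat n n" using A by auto
  obtain q :: "nat \<Rightarrow> real" where q: "\<And>i. 0 \<le> q i" "char_poly ?Q = (\<Prod>i<n. [:- q i, 1:])"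
    "(\<Sum>i<n. q i) = (\<Sum>i<n. ?Q $$ (i, i))"
    "(\<Sum>i<n. (q i)\<^sup>2) = (\<Sum>i<n. \<Sum>j<n. (?Q $$ (i, j))\<^sup>2)"
    using gram_spectrum[OF A] by blast
  show thesis
  proof (rule that[of q])
    show "0 \<le> q i" for i by (rule q(1))
    show "incidence_eigenvalues vs es = image_mset q (mset_set {..<n})"
      unfolding incidence_eigenvalues_def A_def[symmetric] q(2)
      by (subst proots_prod) (auto simp: sum_unfold_sum_mset)
    show tr: "(\<Sum>i<n. q i) = 2 * real m"
      unfolding q(3) unfolding A_def n_def m_def by (rule incidence_gram_trace[OF G])
    have fr: "(\<Sum>i<n. (q i)\<^sup>2) = (\<Sum>k<m. \<Sum>l<m. (real (card (es ! k \<inter> es ! l)))\<^sup>2)"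
      unfolding q(4) unfolding A_def n_def m_def by (rule incidence_gram_frobenius[OF G])
    show "(\<Sum>i<n. q i)\<^sup>2 = (\<Sum>i<n. (q i)\<^sup>2) \<longleftrightarrow> m \<le> 1"
      unfolding tr fr unfolding m_def by (rule edge_intersection_sum_eq_iff[OF G])
    show "(\<Sum>i<n. q i)\<^sup>2 < real n * (\<Sum>i<n. (q i)\<^sup>2)" if "0 < m"
    proof -
      have "es ! 0 \<subseteq> set vs" "card (es ! 0) = 2"
        using G that by (auto simp: simple_graph_def m_def)
      then obtain x y where xy: "es ! 0 = {x, y}" "x \<noteq> y" "x \<in> set vs" "y \<in> set vs"
        by (auto simp: card_2_iff)
      then obtain a b where ab: "a < n" "b < n" "vs ! a = x" "vs ! b = y"
        by (auto simp: in_set_conv_nth n_def)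
      have "?Q $$ (a, b) = (\<Sum>k<m. of_bool (x \<in> es ! k \<and> y \<in> es ! k))"
        using ab incidence_gram_entry[of a vs b es] by (simp add: A_def n_def m_def)
      moreover have "0 < (\<Sum>k<m. of_bool (x \<in> es ! k \<and> y \<in> es ! k) :: real)"
        by (rule sum_pos2[of _ 0]) (use that xy in auto)
      ultimately have "?Q $$ (a, b) \<noteq> 0" by linarith
      moreover have "a \<noteq> b" using ab xy by auto
      ultimately show ?thesis
        unfolding q(3,4) using ab by (intro trace_square_less_card_frobenius[of a n b]) auto
    qed
    show "(\<Prod>i<n. 1 + t * q i) = det (1\<^sub>m n + t \<cdot>\<^sub>m ?Q)" if "0 < t" for t
      using det_one_plus_smult[OF Q q(2) that] by simp
  qed
qed

section \<open>Comparing sums of square roots\<close>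

text \<open>
  A primitive of \<open>ln (1 + s\<^sup>2 / x\<^sup>2)\<close> in \<open>x\<close>. It increases from \<open>0\<close> at \<open>0\<close> to \<open>\<pi> s\<close> at infinity, which is
  the integral formula \<open>\<pi> s = \<integral>\<^sub>0\<^sup>\<infinity> ln (1 + s\<^sup>2 / x\<^sup>2) dx\<close> stated without an integral. The convention
  \<open>x / 0 = 0\<close> makes it vanish identically for \<open>s = 0\<close>.
\<close>

definition log_primitive :: "real \<Rightarrow> real \<Rightarrow> real" where
  "log_primitive s x = x * ln (1 + s\<^sup>2 / x\<^sup>2) + 2 * s * arctan (x / s)"

lemma log_primitive_0 [simp]: "log_primitive 0 = (\<lambda>_. 0)"
  by (simp add: log_primitive_def fun_eq_iff)

lemma log_primitive_deriv:
  assumes "0 \<le> s" "0 < x"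
  shows "(log_primitive s has_real_derivative ln (1 + s\<^sup>2 / x\<^sup>2)) (at x)"
proof (cases "s = 0")
  case True
  hence "log_primitive s = (\<lambda>_. 0)" by auto
  thus ?thesis using True by simp
next
  case False
  have pos: "0 < 1 + s\<^sup>2 / x\<^sup>2" "0 < x\<^sup>2 + s\<^sup>2" "0 < 1 + (x / s)\<^sup>2"
    using assms by (auto intro!: add_pos_nonneg)
  have "((\<lambda>x. x * ln (1 + s\<^sup>2 / x\<^sup>2) + 2 * s * arctan (x / s)) has_real_derivative
      (1 * ln (1 + s\<^sup>2 / x\<^sup>2) + inverse (1 + s\<^sup>2 / x\<^sup>2) * (- s\<^sup>2 * (2 * x) / x ^ 4) * x
        + 2 * s * (inverse (1 + (x / s)\<^sup>2) * (1 / s)))) (at x)"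
    using assms pos False by (auto intro!: derivative_eq_intros simp: divide_inverse mult_ac power2_eq_square power4_eq_xxxx)
  also have "1 * ln (1 + s\<^sup>2 / x\<^sup>2) + inverse (1 + s\<^sup>2 / x\<^sup>2) * (- s\<^sup>2 * (2 * x) / x ^ 4) * x
        + 2 * s * (inverse (1 + (x / s)\<^sup>2) * (1 / s)) = ln (1 + s\<^sup>2 / x\<^sup>2)"
  proof -
    have "inverse (1 + s\<^sup>2 / x\<^sup>2) = x\<^sup>2 / (x\<^sup>2 + s\<^sup>2)"
      using assms by (simp add: field_simps)
    moreover have "inverse (1 + (x / s)\<^sup>2) = s\<^sup>2 / (x\<^sup>2 + s\<^sup>2)"
      using False by (simp add: field_simps)
    moreover have "x\<^sup>2 / (x\<^sup>2 + s\<^sup>2) * (- s\<^sup>2 * (2 * x) / x ^ 4) * x = - (2 * s\<^sup>2 / (x\<^sup>2 + s\<^sup>2))"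
    proof -
      have "- s\<^sup>2 * (2 * x) / x ^ 4 * x = - (2 * s\<^sup>2) / x\<^sup>2"
        using assms by (simp add: field_simps power2_eq_square power4_eq_xxxx)
      thus ?thesis using assms by (simp only: mult.assoc) simp
    qed
    moreover have "2 * s * (s\<^sup>2 / (x\<^sup>2 + s\<^sup>2) * (1 / s)) = 2 * s\<^sup>2 / (x\<^sup>2 + s\<^sup>2)"
      using False by (simp add: power2_eq_square)
    ultimately show ?thesis by simp
  qed
  finally show ?thesis unfolding log_primitive_def[abs_def] .
qed

lemma log_primitive_at_0:
  assumes "0 \<le> s"
  shows "(log_primitive s \<longlongrightarrow> 0) (at_right 0)"
proof (cases "s = 0")
  case False
  with assms have "0 < s" by simp
  thus ?thesis unfolding log_primitive_def[abs_def] by real_asymp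
qed simp

lemma log_primitive_at_top:
  assumes "0 \<le> s"
  shows "(log_primitive s \<longlongrightarrow> pi * s) at_top"
proof (cases "s = 0")
  case False
  with assms have "0 < s" by simp
  thus ?thesis unfolding log_primitive_def[abs_def] by real_asymp
qed simp

text \<open>
  With \<open>t = 1 / x\<^sup>2\<close> the hypothesis compares \<open>\<Sum> ln (1 + a\<^sub>i / x\<^sup>2)\<close> and \<open>\<Sum> ln (1 + b\<^sub>i / x\<^sup>2)\<close>, the
  derivatives of sums of \<^const>\<open>log_primitive\<close>. The difference of the two sums therefore increases from
  \<open>0\<close> to its limit \<open>\<pi> (\<Sum> sqrt b\<^sub>i - \<Sum> sqrt a\<^sub>i)\<close>.
\<close>

lemma sum_sqrt_mono_of_prod_le:
  fixes a b :: "nat \<Rightarrow> real"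
  assumes a: "\<And>i. 0 \<le> a i" and b: "\<And>i. 0 \<le> b i"
    and le: "\<And>t. 0 < t \<Longrightarrow> (\<Prod>i<n. 1 + t * a i) \<le> (\<Prod>i<n. 1 + t * b i)"
  shows "(\<Sum>i<n. sqrt (a i)) \<le> (\<Sum>i<n. sqrt (b i))"
proof -
  define F where "F x = (\<Sum>i<n. log_primitive (sqrt (b i)) x) - (\<Sum>i<n. log_primitive (sqrt (a i)) x)" for x
  have ln_sum: "(\<Sum>i<n. ln (1 + (sqrt (c i))\<^sup>2 / x\<^sup>2)) = ln (\<Prod>i<n. 1 + (1 / x\<^sup>2) * c i)"
    if "\<And>i. 0 \<le> c i" for c :: "nat \<Rightarrow> real" and x :: real
  proof -
    have nn: "0 \<le> (1 / x\<^sup>2) * c i" for i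
      using that by (intro mult_nonneg_nonneg) auto
    hence "1 + (1 / x\<^sup>2) * c i \<noteq> 0" for i using nn[of i] by linarith
    hence "ln (\<Prod>i<n. 1 + (1 / x\<^sup>2) * c i) = (\<Sum>i<n. ln (1 + (1 / x\<^sup>2) * c i))"
      by (intro ln_prod finite_lessThan)
    thus ?thesis using that by simp
  qed
  have deriv: "\<exists>d. (F has_real_derivative d) (at x) \<and> 0 \<le> d" if x: "0 < x" for x
  proof (intro exI conjI)
    show "(F has_real_derivative (\<Sum>i<n. ln (1 + (sqrt (b i))\<^sup>2 / x\<^sup>2)) -
        (\<Sum>i<n. ln (1 + (sqrt (a i))\<^sup>2 / x\<^sup>2))) (at x)"
      unfolding F_def
      by (intro DERIV_diff DERIV_sum log_primitive_deriv real_sqrt_ge_zero a b x)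
    have "0 < (\<Prod>i<n. 1 + (1 / x\<^sup>2) * a i)"
      using a by (intro prod_pos) (auto intro!: add_pos_nonneg)
    thus "0 \<le> (\<Sum>i<n. ln (1 + (sqrt (b i))\<^sup>2 / x\<^sup>2)) - (\<Sum>i<n. ln (1 + (sqrt (a i))\<^sup>2 / x\<^sup>2))"
      using le[of "1 / x\<^sup>2"] x unfolding ln_sum[OF a] ln_sum[OF b]
      by (simp add: ln_mono)
  qed
  have mono: "F x \<le> F y" if "0 < x" "x \<le> y" for x y
    using that(2) by (rule DERIV_nonneg_imp_nondecreasing) (use deriv that(1) in force)
  have "(F \<longlongrightarrow> (\<Sum>i<n. 0) - (\<Sum>i<n. 0)) (at_right 0)"
    unfolding F_def by (intro tendsto_diff tendsto_sum log_primitive_at_0 real_sqrt_ge_zero a b)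
  hence lim0: "(F \<longlongrightarrow> 0) (at_right 0)" by simp
  have nonneg: "0 \<le> F y" if "0 < y" for y
  proof (rule tendsto_upperbound[OF lim0])
    show "\<forall>\<^sub>F x in at_right 0. F x \<le> F y"
      using eventually_at_right_less[of "0::real"] eventually_at_right_real[OF that]
      by eventually_elim (auto intro: mono)
  qed simp
  have "(F \<longlongrightarrow> (\<Sum>i<n. pi * sqrt (b i)) - (\<Sum>i<n. pi * sqrt (a i))) at_top"
    unfolding F_def by (intro tendsto_diff tendsto_sum log_primitive_at_top real_sqrt_ge_zero a b)
  hence "0 \<le> (\<Sum>i<n. pi * sqrt (b i)) - (\<Sum>i<n. pi * sqrt (a i))"
  proof (rule tendsto_lowerbound)
    show "\<forall>\<^sub>F y in at_top. 0 \<le> F y"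
      using eventually_gt_at_top[of 0] by eventually_elim (rule nonneg)
  qed simp
  hence "pi * (\<Sum>i<n. sqrt (a i)) \<le> pi * (\<Sum>i<n. sqrt (b i))"
    by (simp add: sum_distrib_left)
  thus ?thesis by simp
qed

section \<open>Determinants over finite index sets\<close>

text \<open>
  The Leibniz determinant of a matrix whose rows and columns are indexed by a set. Deleting rows and
  columns is then taking a subset, without renumbering.
\<close>

definition set_det :: "('a \<Rightarrow> 'a \<Rightarrow> 'b::comm_ring_1) \<Rightarrow> 'a set \<Rightarrow> 'b" where
  "set_det M W = (\<Sum>p | p permutes W. of_int (sign p) * (\<Prod>i\<in>W. M i (p i)))"

lemma set_det_empty [simp]: "set_det M {} = 1"
  by (simp add: set_det_def)

lemma set_det_reindex:
  assumes f: "bij_betw f A B" and fin: "finite A"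
  shows "set_det M B = set_det (\<lambda>x y. M (f x) (f y)) A"
proof -
  have inj: "inj_on f A" and B: "B = f ` A" using f by (auto simp: bij_betw_def)
  have inv: "inj_on (inv_into A f) B" "bij_betw (inv_into A f) B A"
    using bij_betw_inv_into[OF f] by (auto simp: bij_betw_def)
  have bij: "bij_betw (map_permutation A f) {p. p permutes A} {p. p permutes B}"
  proof (rule bij_betw_byWitness[where f' = "map_permutation B (inv_into A f)"])
    show "\<forall>p\<in>{p. p permutes A}. map_permutation B (inv_into A f) (map_permutation A f p) = p"
      using map_permutation_compose_inv[OF f] inj by auto
    show "\<forall>p\<in>{p. p permutes B}. map_permutation A f (map_permutation B (inv_into A f) p) = p"
      using map_permutation_compose_inv[OF inv(2)] B by (auto simp: f_inv_into_f)
  qed (use map_permutation_permutes[OF f] map_permutation_permutes[OF inv(2)] in auto)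
  have "set_det M B = (\<Sum>p | p permutes A. of_int (sign (map_permutation A f p)) *
      (\<Prod>i\<in>B. M i (map_permutation A f p i)))"
    unfolding set_det_def by (rule sum.reindex_bij_betw[OF bij, symmetric])
  also have "\<dots> = set_det (\<lambda>x y. M (f x) (f y)) A"
    unfolding set_det_def
  proof (rule sum.cong[OF refl])
    fix p assume "p \<in> {p. p permutes A}"
    hence p: "p permutes A" by simp
    have "(\<Prod>i\<in>B. M i (map_permutation A f p i)) = (\<Prod>i\<in>A. M (f i) (f (p i)))"
      unfolding B prod.reindex[OF inj] using map_permutation_apply[OF inj] by auto
    thus "of_int (sign (map_permutation A f p)) * (\<Prod>i\<in>B. M i (map_permutation A f p i)) =
        of_int (sign p) * (\<Prod>i\<in>A. M (f i) (f (p i)))"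
      using sign_map_permutation[OF inj p fin] by simp
  qed
  finally show ?thesis .
qed

lemma permutes_fix_iff: "q permutes W \<and> q v = v \<longleftrightarrow> q permutes (W - {v})"
proof
  assume "q permutes W \<and> q v = v"
  thus "q permutes (W - {v})" by (auto intro: permutes_superset)
next
  assume "q permutes (W - {v})"
  thus "q permutes W \<and> q v = v"
    using permutes_subset[of q "W - {v}" W] permutes_not_in[of q "W - {v}" v] by auto
qed

text \<open>
  A permutation with a nonzero contribution maps \<open>u\<close> to \<open>u\<close> or to \<open>v\<close>; in the second case the only
  nonzero entry of column \<open>u\<close> that is left lies in row \<open>v\<close>, so the permutation exchanges \<open>u\<close> and \<open>v\<close>
  and the transposition contributes the sign.
\<close>

lemma set_det_insert_leaf:
  assumes fin: "finite W" and u: "u \<notin> W" and v: "v \<in> W"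
    and row: "\<And>x. x \<in> W - {v} \<Longrightarrow> M u x = 0" and col: "\<And>x. x \<in> W - {v} \<Longrightarrow> M x u = 0"
  shows "set_det M (insert u W) =
    M u u * set_det M W - M u v * M v u * set_det M (W - {v})"
proof -
  define f where "f p = of_int (sign p) * (\<Prod>i\<in>insert u W. M i (p i))" for p
  define g where "g b = (\<Sum>q | q permutes W. f (transpose u b \<circ> q))" for b
  have f_eq: "f (transpose u b \<circ> q) = of_int (sign (transpose u b \<circ> q)) *
      (M u b * (\<Prod>i\<in>W. M i (transpose u b (q i))))" if "q permutes W" for b q
    using that u fin by (simp add: f_def permutes_not_in)
  have "set_det M (insert u W) = (\<Sum>b\<in>insert u W. g b)"
    unfolding set_det_def f_def[symmetric] g_def
    using fin u by (rule sum_over_permutations_insert)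
  also have "\<dots> = (\<Sum>b\<in>{u, v}. g b)"
  proof (rule sum.mono_neutral_right)
    show "\<forall>b\<in>insert u W - {u, v}. g b = 0"
      unfolding g_def using row by (auto intro!: sum.neutral simp: f_eq)
  qed (use fin v in auto)
  also have "\<dots> = g u + g v" using u v by (subst sum.insert) auto
  also have "g u = M u u * set_det M W"
    unfolding g_def set_det_def sum_distrib_left
    by (intro sum.cong refl) (use f_eq[of _ u] in \<open>simp add: mult_ac\<close>)
  also have "g v = - (M u v * M v u * set_det M (W - {v}))"
  proof -
    have eq: "f (transpose u v \<circ> q) =
        (if q v = v then - (M u v * M v u * (of_int (sign q) * (\<Prod>i\<in>W - {v}. M i (q i)))) else 0)"
      if q: "q permutes W" for q
    proof -
      have "permutation q" using q fin permutation_permutes by blast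
      hence sgn: "sign (transpose u v \<circ> q) = - sign q"
        using u v by (subst sign_compose) (auto simp: permutation_swap_id sign_swap_id)
      show ?thesis
      proof (cases "q v = v")
        case True
        have "(\<Prod>i\<in>W. M i (transpose u v (q i))) =
            M v u * (\<Prod>i\<in>W - {v}. M i (transpose u v (q i)))"
          using fin v True by (subst prod.remove[of _ v]) auto
        also have "(\<Prod>i\<in>W - {v}. M i (transpose u v (q i))) = (\<Prod>i\<in>W - {v}. M i (q i))"
        proof (rule prod.cong[OF refl])
          fix i assume i: "i \<in> W - {v}"
          have "q i \<noteq> v" using True i injD[OF permutes_inj[OF q], of i v] by auto
          moreover have "q i \<noteq> u" using i u permutes_in_image[OF q, of i] by auto
          ultimately show "M i (transpose u v (q i)) = M i (q i)" by simp
        qed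
        finally show ?thesis using True by (simp add: f_eq[OF q] sgn mult_ac)
      next
        case False
        obtain i where i: "q i = v" "i \<in> W"
          using permutes_image[OF q] v by (metis imageE)
        with False have "i \<in> W - {v}" by auto
        hence "M i (transpose u v (q i)) = 0" using col i by simp
        hence "(\<Prod>i\<in>W. M i (transpose u v (q i))) = 0"
          using fin i(2) by (intro prod_zero bexI[of _ i])
        thus ?thesis using False by (simp add: f_eq[OF q])
      qed
    qed
    have "g v = (\<Sum>q | q permutes W.
        (if q v = v then - (M u v * M v u * (of_int (sign q) * (\<Prod>i\<in>W - {v}. M i (q i)))) else 0))"
      unfolding g_def by (rule sum.cong) (auto simp: eq)
    also have "\<dots> = (\<Sum>q | q permutes W \<and> q v = v.
        - (M u v * M v u * (of_int (sign q) * (\<Prod>i\<in>W - {v}. M i (q i)))))"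
      using finite_permutations[OF fin] by (subst sum.inter_filter[symmetric]) simp_all
    also have "\<dots> = - (M u v * M v u * set_det M (W - {v}))"
      unfolding permutes_fix_iff set_det_def sum_distrib_left sum_negf ..
    finally show ?thesis .
  qed
  finally show ?thesis by simp
qed

lemma set_det_insert_isolated:
  assumes fin: "finite W" and u: "u \<notin> W"
    and row: "\<And>x. x \<in> W \<Longrightarrow> M u x = 0" and col: "\<And>x. x \<in> W \<Longrightarrow> M x u = 0"
  shows "set_det M (insert u W) = M u u * set_det M W"
proof (cases "W = {}")
  case True
  thus ?thesis by (simp add: set_det_def)
next
  case False
  then obtain v where v: "v \<in> W" by auto
  show ?thesis using set_det_insert_leaf[OF fin u v, of M] row col v by simp
qed

section \<open>Matchings of the subdivision graph\<close>

fun incident :: "'a + 'a set \<Rightarrow> 'a + 'a set \<Rightarrow> bool" where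
  "incident (Inl v) (Inr e) = (v \<in> e)"
| "incident (Inr e) (Inl v) = (v \<in> e)"
| "incident _ _ = False"

text \<open>
  The entries of the block matrix with rows \<open>(1, - t I)\<close> and \<open>(I\<^sup>T, 1)\<close>, indexed by the vertices
  (\<^const>\<open>Inl\<close>) and the edges (\<^const>\<open>Inr\<close>) of a graph. The leaf recursion sees the two entries at an incident
  pair through their product \<open>- t\<close>.
\<close>

definition subdiv_weight :: "real \<Rightarrow> 'a + 'a set \<Rightarrow> 'a + 'a set \<Rightarrow> real" where
  "subdiv_weight t x y =
     (if x = y then 1 else if incident x y then (if isl x then - t else 1) else 0)"

text \<open>
  If incidence restricted to \<open>W\<close> is acyclic, then only involutions contribute to this determinant,
  and its value is the sum of \<open>t\<^sup>k\<close> over all \<open>k\<close>-matchings of that graph.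
\<close>

definition matching_sum :: "real \<Rightarrow> ('a + 'a set) set \<Rightarrow> real" where
  "matching_sum t W = set_det (subdiv_weight t) W"

lemma incident_sym: "incident x y \<longleftrightarrow> incident y x"
  by (cases x; cases y) auto

lemma matching_sum_empty [simp]: "matching_sum t {} = 1"
  by (simp add: matching_sum_def)

text \<open>
  Matchings that avoid the leaf \<open>u\<close>, and matchings that join it to its only neighbour \<open>v\<close>.
\<close>

lemma matching_sum_leaf:
  assumes "finite W" "u \<notin> W" "v \<in> W" "incident u v"
    and "\<And>x. x \<in> W \<Longrightarrow> incident u x \<Longrightarrow> x = v"
  shows "matching_sum t (insert u W) = matching_sum t W + t * matching_sum t (W - {v})"
proof -
  have "subdiv_weight t u v * subdiv_weight t v u = - t"
    using assms(4) by (cases u; cases v) (auto simp: subdiv_weight_def)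
  moreover have "subdiv_weight t u x = 0 \<and> subdiv_weight t x u = 0" if "x \<in> W - {v}" for x
  proof -
    have "x \<noteq> u" "\<not> incident u x" using that assms(2,5) by blast+
    thus ?thesis using incident_sym[of x u] by (simp add: subdiv_weight_def)
  qed
  ultimately show ?thesis
    unfolding matching_sum_def
    by (subst set_det_insert_leaf[OF assms(1,2,3)]) (auto simp: subdiv_weight_def[of t u u])
qed

lemma matching_sum_isolated:
  assumes "finite W" "u \<notin> W" and "\<And>x. x \<in> W \<Longrightarrow> \<not> incident u x"
  shows "matching_sum t (insert u W) = matching_sum t W"
proof -
  have "subdiv_weight t u x = 0 \<and> subdiv_weight t x u = 0" if "x \<in> W" for x
  proof -
    have "x \<noteq> u" "\<not> incident u x" using that assms(2,3) by blast+
    thus ?thesis using incident_sym[of x u] by (simp add: subdiv_weight_def)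
  qed
  thus ?thesis
    unfolding matching_sum_def
    by (subst set_det_insert_isolated[OF assms(1,2)]) (auto simp: subdiv_weight_def[of t u u])
qed

text \<open>
  The matrix with rows \<open>(1, t I)\<close> and \<open>(0, 1)\<close> has determinant \<open>1\<close>. Multiplied from the left to the
  block matrix with rows \<open>(1, - t I)\<close> and \<open>(I\<^sup>T, 1)\<close> it clears the upper right block and leaves
  \<open>1 + t I I\<^sup>T\<close> in the upper left corner.
\<close>

lemma det_gram_matching_sum:
  fixes vs :: "'a list" and es :: "'a set list" and t :: real
  assumes "distinct vs" "distinct es"
  defines "A \<equiv> incidence_mat vs es"
  shows "det (1\<^sub>m (length vs) + t \<cdot>\<^sub>m (A * transpose_mat A)) =
    matching_sum t (Inl ` set vs \<union> Inr ` set es)"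
proof -
  define n where "n = length vs"
  define m where "m = length es"
  have A: "A \<in> carrier_mat n m" by (simp add: A_def incidence_mat_def n_def m_def)
  define F where "F = four_block_mat (1\<^sub>m n) (- t \<cdot>\<^sub>m A) (transpose_mat A) (1\<^sub>m m)"
  define G where "G = four_block_mat (1\<^sub>m n) (t \<cdot>\<^sub>m A) (0\<^sub>m m n) (1\<^sub>m m)"
  have F: "F \<in> carrier_mat (n + m) (n + m)" and G: "G \<in> carrier_mat (n + m) (n + m)"
    unfolding F_def G_def using A by auto
  have "G * F = four_block_mat (1\<^sub>m n * 1\<^sub>m n + (t \<cdot>\<^sub>m A) * transpose_mat A)
      (1\<^sub>m n * (- t \<cdot>\<^sub>m A) + (t \<cdot>\<^sub>m A) * 1\<^sub>m m)
      (0\<^sub>m m n * 1\<^sub>m n + 1\<^sub>m m * transpose_mat A) (0\<^sub>m m n * (- t \<cdot>\<^sub>m A) + 1\<^sub>m m * 1\<^sub>m m)"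
    unfolding F_def G_def by (rule mult_four_block_mat) (use A in auto)
  also have "1\<^sub>m n * (- t \<cdot>\<^sub>m A) + (t \<cdot>\<^sub>m A) * 1\<^sub>m m = 0\<^sub>m n m"
  proof -
    have "1\<^sub>m n * (- t \<cdot>\<^sub>m A) = - t \<cdot>\<^sub>m A" "(t \<cdot>\<^sub>m A) * 1\<^sub>m m = t \<cdot>\<^sub>m A"
      using A by (simp_all add: left_mult_one_mat[of _ n m] right_mult_one_mat[of _ n m])
    thus ?thesis using A by (intro eq_matI) auto
  qed
  finally have "det (G * F) = det (1\<^sub>m n * 1\<^sub>m n + (t \<cdot>\<^sub>m A) * transpose_mat A) *
      det (0\<^sub>m m n * (- t \<cdot>\<^sub>m A) + 1\<^sub>m m * 1\<^sub>m m)"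
    using A by (simp only:) (rule det_four_block_mat_upper_right_zero, auto)
  also have "0\<^sub>m m n * (- t \<cdot>\<^sub>m A) + 1\<^sub>m m * 1\<^sub>m m = 1\<^sub>m m"
    using A by simp
  also have "1\<^sub>m n * 1\<^sub>m n + (t \<cdot>\<^sub>m A) * transpose_mat A = 1\<^sub>m n + t \<cdot>\<^sub>m (A * transpose_mat A)"
    using A by (simp add: mult_smult_assoc_mat[of _ n m _ n])
  finally have GF: "det (G * F) = det (1\<^sub>m n + t \<cdot>\<^sub>m (A * transpose_mat A))" by simp
  have "det G = 1"
    unfolding G_def by (subst det_four_block_mat_lower_left_zero[of _ n _ m]) (use A in auto)
  hence "det (1\<^sub>m n + t \<cdot>\<^sub>m (A * transpose_mat A)) = det F"
    using GF det_mult[OF G F] by simp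
  also have "det F = set_det (\<lambda>i j. F $$ (i, j)) {0..<n + m}"
    using det_def'[OF F] by (simp add: set_det_def)
  also have "\<dots> = matching_sum t (Inl ` set vs \<union> Inr ` set es)"
  proof -
    \<comment> \<open>The first n indices are the vertices, the remaining ones the edges.\<close>
    define f where "f i = (if i < n then Inl (vs ! i) else Inr (es ! (i - n)))" for i
    have bij: "bij_betw f {0..<n + m} (Inl ` set vs \<union> Inr ` set es)"
    proof (rule bij_betwI')
      fix i j assume "i \<in> {0..<n + m}" "j \<in> {0..<n + m}"
      thus "f i = f j \<longleftrightarrow> i = j"
        using assms by (auto simp: f_def n_def m_def nth_eq_iff_index_eq)
    next
      fix i assume "i \<in> {0..<n + m}"
      thus "f i \<in> Inl ` set vs \<union> Inr ` set es" by (auto simp: f_def n_def m_def)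
    next
      fix y assume "y \<in> Inl ` set vs \<union> Inr ` set es"
      then consider i where "i < n" "y = Inl (vs ! i)" | i where "i < m" "y = Inr (es ! i)"
        by (auto simp: in_set_conv_nth n_def m_def)
      thus "\<exists>i\<in>{0..<n + m}. y = f i"
      proof cases
        case 1
        thus ?thesis by (intro bexI[of _ i]) (auto simp: f_def)
      next
        case 2
        thus ?thesis by (intro bexI[of _ "n + i"]) (auto simp: f_def)
      qed
    qed
    have "F $$ (i, j) = subdiv_weight t (f i) (f j)" if "i < n + m" "j < n + m" for i j
      using that assms(1,2) A
      by (auto simp: F_def f_def subdiv_weight_def A_def incidence_mat_def n_def m_def
          nth_eq_iff_index_eq)
    moreover have "p i < n + m" if "p permutes {0..<n + m}" "i < n + m" for p i
      using permutes_in_image[OF that(1), of i] that(2) by simp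
    ultimately have "set_det (\<lambda>i j. F $$ (i, j)) {0..<n + m} =
        set_det (\<lambda>i j. subdiv_weight t (f i) (f j)) {0..<n + m}"
      unfolding set_det_def by (intro sum.cong refl arg_cong2[of _ _ _ _ "(*)"] prod.cong) auto
    thus ?thesis
      unfolding matching_sum_def by (simp add: set_det_reindex[OF bij])
  qed
  finally show ?thesis by (simp add: n_def)
qed

section \<open>Bounds for trees grown from leaves\<close>

text \<open>
  The matching sum of a path on \<open>k\<close> vertices.
\<close>

fun path_matching :: "real \<Rightarrow> nat \<Rightarrow> real" where
  "path_matching t 0 = 1"
| "path_matching t (Suc 0) = 1"
| "path_matching t (Suc (Suc k)) = path_matching t (Suc k) + t * path_matching t k"

text \<open>
  The matching sum of the subdivision of a star with \<open>k\<close> edges; in closed form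
  \<open>(1 + t)\<^sup>k\<^sup>-\<^sup>1 (1 + (k + 1) t)\<close> for \<open>k \<ge> 1\<close>.
\<close>

fun star_matching :: "real \<Rightarrow> nat \<Rightarrow> real" where
  "star_matching t 0 = 1"
| "star_matching t (Suc k) = (1 + t) * star_matching t k + t * (1 + t) ^ k"

lemma path_matching_nonneg: "0 \<le> t \<Longrightarrow> 0 \<le> path_matching t k"
  by (induction t k rule: path_matching.induct) auto

lemma path_matching_Suc_mono: "0 \<le> t \<Longrightarrow> path_matching t k \<le> path_matching t (Suc k)"
  by (cases k) (auto simp: path_matching_nonneg)

lemma power_le_star_matching: "0 \<le> t \<Longrightarrow> (1 + t) ^ k \<le> star_matching t k"
proof (induction k)
  case (Suc k)
  have "(1 + t) * (1 + t) ^ k \<le> (1 + t) * star_matching t k"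
    using Suc by (intro mult_left_mono) auto
  moreover have "0 \<le> t * (1 + t) ^ k" using Suc.prems by auto
  ultimately show ?case by simp
qed simp

text \<open>
  All induced subgraphs are included since the leaf recursion leads to subgraphs that are no longer
  connected.
\<close>

definition matching_bounded :: "real \<Rightarrow> ('a + 'a set) set \<Rightarrow> bool" where
  "matching_bounded t X \<longleftrightarrow> finite X \<and>
     (\<forall>W\<subseteq>X. 0 \<le> matching_sum t W \<and> matching_sum t W \<le> path_matching t (card W))"

text \<open>
  The leaf recursion of \<open>W\<close> has exactly the shape of the recursion of \<^const>\<open>path_matching\<close>, except that
  a set in which \<open>x\<close> is isolated loses the second summand. So among all forests on a given number of
  vertices the path is extremal.
\<close>

lemma matching_bounded_insert:
  assumes t: "0 \<le> t" and X: "matching_bounded t X" and x: "x \<notin> X"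
    and nb: "\<And>y. y \<in> X \<Longrightarrow> incident x y \<Longrightarrow> y = v"
  shows "matching_bounded t (insert x X)"
  unfolding matching_bounded_def
proof (intro conjI allI impI)
  show "finite (insert x X)" using X by (simp add: matching_bounded_def)
next
  fix W assume W: "W \<subseteq> insert x X"
  define Y where "Y = W - {x}"
  have Y: "Y \<subseteq> X" "finite Y" "x \<notin> Y"
    using W X finite_subset by (auto simp: Y_def matching_bounded_def)
  have bd: "0 \<le> matching_sum t Z \<and> matching_sum t Z \<le> path_matching t (card Z)"
    if "Z \<subseteq> X" for Z
    using X that by (simp add: matching_bounded_def)
  have "0 \<le> matching_sum t W \<and> matching_sum t W \<le> path_matching t (card W)"
  proof (cases "x \<in> W")
    case False
    hence "W \<subseteq> X" using W by auto
    thus ?thesis by (rule bd)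
  next
    case True
    hence W_eq: "W = insert x Y" by (auto simp: Y_def)
    show ?thesis
    proof (cases "\<exists>y\<in>Y. incident x y")
      case True
      hence v: "v \<in> Y" "incident x v" using nb Y(1) by blast+
      have eq: "matching_sum t W = matching_sum t Y + t * matching_sum t (Y - {v})"
        unfolding W_eq by (rule matching_sum_leaf) (use Y v nb in blast)+
      have "card W = Suc (Suc (card (Y - {v})))" "card Y = Suc (card (Y - {v}))"
        using Y(2,3) card_Suc_Diff1[OF Y(2) v(1)] unfolding W_eq by simp_all
      moreover have "Y - {v} \<subseteq> X" using Y by auto
      ultimately show ?thesis
        using bd[OF Y(1)] bd[of "Y - {v}"] t unfolding eq
        by (auto intro!: add_mono mult_left_mono)
    next
      case False
      have "matching_sum t W = matching_sum t Y"
        unfolding W_eq by (rule matching_sum_isolated) (use Y False in auto)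
      moreover have "card W = Suc (card Y)" using Y unfolding W_eq by simp
      ultimately show ?thesis
        using bd[OF Y(1)] path_matching_Suc_mono[OF t, of "card Y"] by simp
    qed
  qed
  thus "0 \<le> matching_sum t W" "matching_sum t W \<le> path_matching t (card W)" by auto
qed

definition subdivision :: "'a set \<Rightarrow> 'a set set \<Rightarrow> ('a + 'a set) set" where
  "subdivision U F = Inl ` U \<union> Inr ` F"

lemma subdivision_insert:
  "subdivision (insert v U) (insert e F) = insert (Inl v) (insert (Inr e) (subdivision U F))"
  by (auto simp: subdivision_def)

lemma incident_new_edge:
  assumes "v \<notin> U" "x \<in> subdivision U F" "incident (Inr {v, w}) x"
  shows "x = Inl w"
  using assms by (auto simp: subdivision_def)

lemma incident_new_leaf:
  assumes "v \<notin> U" "\<Union>F \<subseteq> U" "x \<in> insert (Inr e) (subdivision U F)" "incident (Inl v) x"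
  shows "x = Inr e"
proof -
  have "v \<notin> f" if "f \<in> F" for f using assms(1,2) that by blast
  thus ?thesis using assms(3,4) by (auto simp: subdivision_def)
qed

lemma new_notin_subdivision:
  assumes "v \<notin> U" "\<Union>F \<subseteq> U"
  shows "Inr {v, w} \<notin> subdivision U F" "Inl v \<notin> insert (Inr e) (subdivision U F)"
  using assms by (auto simp: subdivision_def)

text \<open>
  In the subdivision, attaching the leaf \<open>v\<close> at \<open>w\<close> means hanging the edge \<open>{v, w}\<close> on \<open>w\<close> and then \<open>v\<close>
  on that edge. The set \<open>W\<close> may have lost \<open>w\<close>, which leaves the new edge isolated.
\<close>

lemma matching_sum_new_edge:
  assumes "finite W" "W \<subseteq> subdivision U F" "v \<notin> U" "\<Union>F \<subseteq> U"
  shows "matching_sum t (insert (Inr {v, w}) W) =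
    matching_sum t W + (if Inl w \<in> W then t * matching_sum t (W - {Inl w}) else 0)"
proof (cases "Inl w \<in> W")
  case True
  have "matching_sum t (insert (Inr {v, w}) W) = matching_sum t W + t * matching_sum t (W - {Inl w})"
  proof (rule matching_sum_leaf)
    show "Inr {v, w} \<notin> W" using new_notin_subdivision(1)[OF assms(3,4)] assms(2) by blast
    show "x = Inl w" if "x \<in> W" "incident (Inr {v, w}) x" for x
      using incident_new_edge[OF assms(3)] that assms(2) by blast
  qed (use assms(1) True in auto)
  thus ?thesis using True by simp
next
  case False
  have "matching_sum t (insert (Inr {v, w}) W) = matching_sum t W"
  proof (rule matching_sum_isolated)
    show "Inr {v, w} \<notin> W" using new_notin_subdivision(1)[OF assms(3,4)] assms(2) by blast
    show "\<not> incident (Inr {v, w}) x" if "x \<in> W" for x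
      using incident_new_edge[OF assms(3), of x F w] that assms(2) False by blast
  qed (rule assms(1))
  thus ?thesis using False by simp
qed

lemma matching_sum_new_leaf:
  assumes "finite W" "W \<subseteq> subdivision U F" "v \<notin> U" "\<Union>F \<subseteq> U"
  shows "matching_sum t (insert (Inl v) (insert (Inr {v, w}) W)) =
    matching_sum t (insert (Inr {v, w}) W) + t * matching_sum t W"
proof -
  have notin: "Inr {v, w} \<notin> W" "Inl v \<notin> insert (Inr {v, w}) W"
    using new_notin_subdivision[OF assms(3,4)] assms(2) by blast+
  have "matching_sum t (insert (Inl v) (insert (Inr {v, w}) W)) =
    matching_sum t (insert (Inr {v, w}) W) + t * matching_sum t (insert (Inr {v, w}) W - {Inr {v, w}})"
  proof (rule matching_sum_leaf)
    show "x = Inr {v, w}" if "x \<in> insert (Inr {v, w}) W" "incident (Inl v) x" for x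
      using incident_new_leaf[OF assms(3,4), of x] that assms(2) by blast
  qed (use assms(1) notin in auto)
  thus ?thesis using notin by simp
qed

inductive grown_tree :: "'a set \<Rightarrow> 'a set set \<Rightarrow> bool" where
  single: "grown_tree {v} {}"
| leaf: "grown_tree U F \<Longrightarrow> w \<in> U \<Longrightarrow> v \<notin> U \<Longrightarrow> grown_tree (insert v U) (insert {v, w} F)"

lemma grown_tree_basic:
  assumes "grown_tree U F"
  shows "finite U \<and> finite F \<and> \<Union>F \<subseteq> U \<and> card U = Suc (card F)"
  using assms
proof induction
  case (leaf U F w v)
  hence "{v, w} \<notin> F" by auto
  thus ?case using leaf by auto
qed auto

lemma finite_subdivision: "finite U \<Longrightarrow> finite F \<Longrightarrow> finite (subdivision U F)"
  by (simp add: subdivision_def)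

lemma grown_tree_matching_bounded:
  assumes "grown_tree U F" "0 \<le> t"
  shows "matching_bounded t (subdivision U F)"
  using assms
proof induction
  case (single v)
  have "matching_bounded t {}" by (auto simp: matching_bounded_def)
  hence "matching_bounded t (insert (Inl v) {})"
    by (rule matching_bounded_insert[OF single]) auto
  thus ?case by (simp add: subdivision_def)
next
  case (leaf U F w v)
  have sub: "\<Union>F \<subseteq> U" using grown_tree_basic[OF leaf.hyps(1)] by simp
  note notin = new_notin_subdivision[OF leaf.hyps(3) sub]
  have "matching_bounded t (insert (Inr {v, w}) (subdivision U F))"
    using leaf.prems leaf.IH[OF leaf.prems] notin(1)
    by (rule matching_bounded_insert) (rule incident_new_edge[OF leaf.hyps(3)])
  with leaf.prems have "matching_bounded t (insert (Inl v) (insert (Inr {v, w}) (subdivision U F)))"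
    using notin(2) by (rule matching_bounded_insert) (rule incident_new_leaf[OF leaf.hyps(3) sub])
  thus ?case by (simp only: subdivision_insert)
qed

lemma grown_tree_matching_le_path:
  assumes "grown_tree U F" "0 \<le> t"
  shows "matching_sum t (subdivision U F) \<le> path_matching t (2 * card F + 1)"
proof -
  have "card (subdivision U F) = card U + card F"
    using grown_tree_basic[OF assms(1)]
    by (simp add: subdivision_def card_Plus flip: Plus_def)
  thus ?thesis
    using grown_tree_matching_bounded[OF assms] grown_tree_basic[OF assms(1)]
    by (auto simp: matching_bounded_def mult_2)
qed

text \<open>
  Attaching \<open>v\<close> at \<open>w\<close> replaces \<open>M(S)\<close> by \<open>(1 + t) M(S) + t M(S - w)\<close>, where \<open>S\<close> is the subdivision.
  The second summand is bounded from below along the same induction: after removal of one vertex, the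
  remaining vertices are matched with the edges by orienting the tree towards the removed vertex, and
  the submatchings of this perfect matching alone contribute \<open>(1 + t)\<^sup>k\<close> with \<open>k = card F\<close>. For the star
  with its centre removed nothing else is left, which makes the star the minimum.
\<close>

lemma star_le_grown_tree_matching:
  assumes "grown_tree U F" "0 \<le> t"
  shows "star_matching t (card F) \<le> matching_sum t (subdivision U F) \<and>
    (\<forall>z\<in>U. (1 + t) ^ card F \<le> matching_sum t (subdivision U F - {Inl z}))"
  using assms
proof induction
  case (single v)
  have "matching_sum t {Inl v} = 1"
    using matching_sum_isolated[of "{}" "Inl v" t] by simp
  thus ?case by (simp add: subdivision_def)
next
  case (leaf U F w v)
  let ?S = "subdivision U F" and ?e = "Inr {v, w}"
  have fin: "finite ?S" "finite F" and sub: "\<Union>F \<subseteq> U"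
    using grown_tree_basic[OF leaf.hyps(1)] by (auto simp: finite_subdivision)
  have wS: "Inl w \<in> ?S" using leaf.hyps by (simp add: subdivision_def)
  have card: "card (insert {v, w} F) = Suc (card F)"
    using fin sub leaf.hyps(3) by (subst card_insert_disjoint) auto
  note edge = matching_sum_new_edge[OF _ _ leaf.hyps(3) sub, of _ t w]
  note vert = matching_sum_new_leaf[OF _ _ leaf.hyps(3) sub, of _ t w]
  have IH1: "star_matching t (card F) \<le> matching_sum t ?S"
    and IH2: "\<And>z. z \<in> U \<Longrightarrow> (1 + t) ^ card F \<le> matching_sum t (?S - {Inl z})"
    using leaf.IH[OF leaf.prems] by auto
  have IH2w: "t * (1 + t) ^ card F \<le> t * matching_sum t (?S - {Inl w})"
    using IH2[OF leaf.hyps(2)] leaf.prems by (rule mult_left_mono)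
  \<comment> \<open>The sum for the intermediate graph, in which the new edge hangs on w and v is still missing.\<close>
  have ext_edge: "matching_sum t (insert ?e ?S) = matching_sum t ?S + t * matching_sum t (?S - {Inl w})"
    using edge[OF fin(1) subset_refl] wS by simp
  have "star_matching t (Suc (card F)) \<le> (1 + t) * matching_sum t ?S + t * matching_sum t (?S - {Inl w})"
    unfolding star_matching.simps using IH1 IH2[OF leaf.hyps(2)] leaf.prems
    by (intro add_mono mult_left_mono) auto
  also have "\<dots> = matching_sum t (insert (Inl v) (insert ?e ?S))"
    using vert[OF fin(1) subset_refl] ext_edge by (simp add: algebra_simps)
  finally have A: "star_matching t (Suc (card F)) \<le> matching_sum t (insert (Inl v) (insert ?e ?S))" .
  have B: "(1 + t) ^ Suc (card F) \<le> matching_sum t (insert (Inl v) (insert ?e ?S) - {Inl z})"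
    if z: "z \<in> insert v U" for z
  proof (cases "z = v")
    case True
    have "insert (Inl v) (insert ?e ?S) - {Inl z} = insert ?e ?S"
      using True new_notin_subdivision(2)[OF leaf.hyps(3) sub, of "{v, w}"] by auto
    moreover have "(1 + t) ^ Suc (card F) \<le> star_matching t (card F) + t * (1 + t) ^ card F"
      using power_le_star_matching[OF leaf.prems, of "card F"] by (simp add: algebra_simps)
    ultimately show ?thesis using IH1 IH2w ext_edge by simp
  next
    case False
    let ?W = "?S - {Inl z}"
    have W: "finite ?W" "?W \<subseteq> ?S" using fin by auto
    have "0 \<le> matching_sum t (?W - {Inl w})"
      using grown_tree_matching_bounded[OF leaf.hyps(1) leaf.prems] W
      unfolding matching_bounded_def by blast
    hence "matching_sum t ?W \<le> matching_sum t (insert ?e ?W)"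
      using edge[OF W] leaf.prems by simp
    moreover have "insert (Inl v) (insert ?e ?S) - {Inl z} = insert (Inl v) (insert ?e ?W)"
      using False by auto
    ultimately have "(1 + t) * matching_sum t ?W \<le> matching_sum t (insert (Inl v) (insert ?e ?S) - {Inl z})"
      using vert[OF W] by (simp add: algebra_simps)
    moreover have "(1 + t) * (1 + t) ^ card F \<le> (1 + t) * matching_sum t ?W"
      using IH2[of z] z False leaf.prems by (intro mult_left_mono) auto
    ultimately show ?thesis by simp
  qed
  show ?case unfolding subdivision_insert card using A B by blast
qed

text \<open>
  The subdivision of a path is a path; without its last vertex it ends in the last edge. The two
  values feed the recursion by two steps.
\<close>

lemma matching_sum_path_edges:
  "matching_sum t (subdivision {0..<Suc k} (set (path_edges (Suc k)))) = path_matching t (2 * k + 1) \<and>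
   matching_sum t (subdivision {0..<Suc k} (set (path_edges (Suc k))) - {Inl k}) = path_matching t (2 * k)"
proof (induction k)
  case 0
  have "matching_sum t {Inl 0} = 1"
    using matching_sum_isolated[of "{}" "Inl 0" t] by simp
  thus ?case by (simp add: subdivision_def path_edges_def)
next
  case (Suc k)
  let ?F = "set (path_edges (Suc k))"
  let ?S = "subdivision {0..<Suc k} ?F" and ?e = "Inr {Suc k, k}"
  have S': "subdivision {0..<Suc (Suc k)} (set (path_edges (Suc (Suc k)))) = insert (Inl (Suc k)) (insert ?e ?S)"
    unfolding subdivision_insert[symmetric]
    by (rule arg_cong2[of _ _ _ _ subdivision]) (auto simp: path_edges_def atLeast0_lessThan_Suc insert_commute)
  have fin: "finite ?S" by (simp add: subdivision_def)
  have v: "Suc k \<notin> {0..<Suc k}" and sub: "\<Union>?F \<subseteq> {0..<Suc k}" by (auto simp: path_edges_def)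
  have "insert (Inl (Suc k)) (insert ?e ?S) - {Inl (Suc k)} = insert ?e ?S"
    using new_notin_subdivision(2)[OF v sub] by auto
  moreover have "matching_sum t (insert ?e ?S) = path_matching t (Suc (Suc (2 * k)))"
    using matching_sum_new_edge[OF fin subset_refl v sub, of t k] Suc.IH
    by (simp add: subdivision_def)
  moreover have "matching_sum t (insert (Inl (Suc k)) (insert ?e ?S)) =
      path_matching t (Suc (Suc (2 * k))) + t * path_matching t (Suc (2 * k))"
    using matching_sum_new_leaf[OF fin subset_refl v sub, of t k] Suc.IH calculation(2) by simp
  ultimately show ?case unfolding S' by simp
qed

lemma matching_sum_star_edges:
  "matching_sum t (subdivision {0..<Suc k} (set (star_edges (Suc k)))) = star_matching t k \<and>
   matching_sum t (subdivision {0..<Suc k} (set (star_edges (Suc k))) - {Inl 0}) = (1 + t) ^ k"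
proof (induction k)
  case 0
  have "matching_sum t {Inl 0} = 1"
    using matching_sum_isolated[of "{}" "Inl 0" t] by simp
  thus ?case by (simp add: subdivision_def star_edges_def)
next
  case (Suc k)
  let ?F = "set (star_edges (Suc k))"
  let ?S = "subdivision {0..<Suc k} ?F" and ?e = "Inr {Suc k, 0}"
  have S': "subdivision {0..<Suc (Suc k)} (set (star_edges (Suc (Suc k)))) = insert (Inl (Suc k)) (insert ?e ?S)"
    unfolding subdivision_insert[symmetric]
    by (rule arg_cong2[of _ _ _ _ subdivision]) (auto simp: star_edges_def atLeast0_lessThan_Suc insert_commute)
  have fin: "finite ?S" "finite (?S - {Inl 0})" by (simp_all add: subdivision_def)
  have v: "Suc k \<notin> {0..<Suc k}" and sub: "\<Union>?F \<subseteq> {0..<Suc k}" by (auto simp: star_edges_def)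
  have "insert (Inl (Suc k)) (insert ?e ?S) - {Inl 0} = insert (Inl (Suc k)) (insert ?e (?S - {Inl 0}))"
    by auto
  moreover have "matching_sum t (insert ?e ?S) = star_matching t k + t * (1 + t) ^ k"
    using matching_sum_new_edge[OF fin(1) subset_refl v sub, of t 0] Suc.IH
    by (simp add: subdivision_def)
  moreover have "matching_sum t (insert ?e (?S - {Inl 0})) = (1 + t) ^ k"
    using matching_sum_new_edge[OF fin(2) Diff_subset v sub, of t 0] Suc.IH by simp
  ultimately show ?case unfolding S'
    using matching_sum_new_leaf[OF fin(1) subset_refl v sub, of t 0]
      matching_sum_new_leaf[OF fin(2) Diff_subset v sub, of t 0] Suc.IH
    by (simp add: algebra_simps)
qed

section \<open>Every tree grows from leaves\<close>

text \<open>
  Needed in order to close a cycle when a vertex has two neighbours in a tree.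
\<close>

lemma grown_tree_connecting_path:
  assumes "grown_tree U F" "a \<in> U" "b \<in> U"
  shows "\<exists>p. p \<noteq> [] \<and> hd p = a \<and> last p = b \<and> distinct p \<and> set p \<subseteq> U \<and>
    successively (\<lambda>x y. {x, y} \<in> F) p"
  using assms
proof (induction arbitrary: a b)
  case (single v)
  thus ?case by (intro exI[of _ "[v]"]) auto
next
  case (leaf U F w v)
  let ?adj = "\<lambda>F x y. {x, y} \<in> F"
  have mono: "successively (?adj F) p \<Longrightarrow> successively (?adj (insert {v, w} F)) p" for p
    by (erule successively_mono) auto
  consider "a = v" "b = v" | "a = v" "b \<in> U" | "a \<in> U" "b = v" | "a \<in> U" "b \<in> U"
    using leaf.prems by auto
  thus ?case
  proof cases
    case 1
    thus ?thesis by (intro exI[of _ "[v]"]) auto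
  next
    case 2
    obtain p where p: "p \<noteq> []" "hd p = w" "last p = b" "distinct p" "set p \<subseteq> U" "successively (?adj F) p"
      using leaf.IH[OF leaf.hyps(2) 2(2)] by blast
    show ?thesis
      using p 2 leaf.hyps(3) mono[OF p(6)]
      by (intro exI[of _ "v # p"]) (auto simp: successively_Cons)
  next
    case 3
    obtain p where p: "p \<noteq> []" "hd p = a" "last p = w" "distinct p" "set p \<subseteq> U" "successively (?adj F) p"
      using leaf.IH[OF 3(1) leaf.hyps(2)] by blast
    show ?thesis
      using p 3 leaf.hyps(3) mono[OF p(6)]
      by (intro exI[of _ "p @ [v]"]) (auto simp: successively_append_iff insert_commute)
  next
    case 4
    obtain p where p: "p \<noteq> []" "hd p = a" "last p = b" "distinct p" "set p \<subseteq> U" "successively (?adj F) p"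
      using leaf.IH[OF 4] by blast
    show ?thesis
      using p mono[OF p(6)] by (intro exI[of _ p]) auto
  qed
qed

lemma path_closes_to_cycle:
  assumes p: "distinct p" "successively (\<lambda>x y. {x, y} \<in> set es) p" "2 \<le> length p" "z \<notin> set p"
    and ends: "{last p, z} \<in> set es" "{z, hd p} \<in> set es"
  shows "is_cycle es (p @ [z])"
  unfolding is_cycle_def
proof (intro conjI allI impI)
  fix i assume i: "i < length (p @ [z])"
  \<comment> \<open>The successor of an index is the next vertex of the path, the closing vertex z, or the first vertex again.\<close>
  consider "Suc i < length p" | "Suc i = length p" | "i = length p" using i by fastforce
  thus "{(p @ [z]) ! i, (p @ [z]) ! (Suc i mod length (p @ [z]))} \<in> set es"
  proof cases
    case 1
    hence "{p ! i, p ! Suc i} \<in> set es"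
      using p(2) successively_conv_nth[of "\<lambda>x y. {x, y} \<in> set es" p] by auto
    thus ?thesis using 1 by (simp add: nth_append)
  next
    case 2
    hence "p ! i = last p" by (metis diff_Suc_1 last_conv_nth length_0_conv nat.distinct(1))
    thus ?thesis using 2 ends(1) by (simp add: nth_append flip: 2)
  next
    case 3
    have "p \<noteq> []" using p(3) by auto
    thus ?thesis using 3 ends(2) by (simp add: nth_append hd_conv_nth)
  qed
qed (use p in auto)

text \<open>
  Take a maximal vertex set \<open>U\<close> on which the graph induces a tree grown from leaves. If \<open>U\<close> misses a
  vertex, then connectedness yields an edge from \<open>y\<close> in \<open>U\<close> to some \<open>z\<close> outside. A second neighbour of
  \<open>z\<close> in \<open>U\<close> would be joined to \<open>y\<close> by a path inside \<open>U\<close> and so close a cycle. Hence \<open>z\<close> is attached as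
  a leaf, against maximality.
\<close>

lemma is_tree_imp_grown_tree:
  assumes "is_tree vs es"
  shows "grown_tree (set vs) (set es)"
proof -
  have simple: "\<And>e. e \<in> set es \<Longrightarrow> e \<subseteq> set vs \<and> card e = 2"
    and ne: "vs \<noteq> []" and conn: "connected_graph vs es" and acyc: "\<And>c. \<not> is_cycle es c"
    using assms by (auto simp: is_tree_def simple_graph_def)
  define \<U> where "\<U> = {U. U \<subseteq> set vs \<and> grown_tree U {e \<in> set es. e \<subseteq> U}}"
  have fin: "finite \<U>" by (rule finite_subset[of _ "Pow (set vs)"]) (auto simp: \<U>_def)
  have "{e \<in> set es. e \<subseteq> {hd vs}} = {}"
  proof -
    have False if "e \<in> set es" "e \<subseteq> {hd vs}" for e
      using simple[OF that(1)] card_mono[OF _ that(2)] by simp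
    thus ?thesis by blast
  qed
  hence "grown_tree {hd vs} {e \<in> set es. e \<subseteq> {hd vs}}"
    by (simp only: grown_tree.single)
  hence "{hd vs} \<in> \<U>" using ne by (simp add: \<U>_def)
  then obtain U where U: "U \<in> \<U>" and max: "\<And>U'. U' \<in> \<U> \<Longrightarrow> U \<subseteq> U' \<Longrightarrow> U' = U"
    using finite_has_maximal[OF fin] by blast
  let ?F = "{e \<in> set es. e \<subseteq> U}"
  have tree: "grown_tree U ?F" and Uvs: "U \<subseteq> set vs" using U by (auto simp: \<U>_def)
  have "U = set vs"
  proof (rule ccontr)
    assume "U \<noteq> set vs"
    then obtain x where x: "x \<in> set vs" "x \<notin> U" using Uvs by auto
    have "U \<noteq> {}" using grown_tree_basic[OF tree] by auto
    then obtain u where u: "u \<in> U" by auto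
    have "\<exists>y z. y \<in> U \<and> z \<notin> U \<and> {y, z} \<in> set es"
    proof (rule ccontr)
      assume no: "\<not> ?thesis"
      have "(u, x) \<in> {(x, y). {x, y} \<in> set es}\<^sup>*"
        using conn u Uvs x(1) by (auto simp: connected_graph_def)
      hence "x \<in> U"
        by (induction rule: rtrancl_induct) (use u no in auto)
      with x(2) show False ..
    qed
    then obtain y z where yz: "y \<in> U" "z \<notin> U" "{y, z} \<in> set es" by blast
    have "{e \<in> set es. e \<subseteq> insert z U} = insert {z, y} ?F"
    proof (intro equalityI subsetI)
      fix e assume "e \<in> insert {z, y} ?F"
      thus "e \<in> {e \<in> set es. e \<subseteq> insert z U}" using yz by (auto simp: insert_commute)
    next
      fix e assume e: "e \<in> {e \<in> set es. e \<subseteq> insert z U}"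
      show "e \<in> insert {z, y} ?F"
      proof (cases "z \<in> e")
        case False
        thus ?thesis using e by auto
      next
        case True
        obtain y' where y': "e = {z, y'}" "y' \<noteq> z"
          using simple[of e] e True by (auto simp: card_2_iff)
        hence y'U: "y' \<in> U" using e by auto
        have "y' = y"
        proof (rule ccontr)
          assume "y' \<noteq> y"
          obtain p where p: "p \<noteq> []" "hd p = y" "last p = y'" "distinct p" "set p \<subseteq> U"
            "successively (\<lambda>a b. {a, b} \<in> ?F) p"
            using grown_tree_connecting_path[OF tree yz(1) y'U] by blast
          have "length p \<noteq> 1" using p(2,3) \<open>y' \<noteq> y\<close> by (auto simp: length_Suc_conv)
          hence len: "2 \<le> length p" using p(1) by (cases p) (auto simp: Suc_le_eq)
          have "is_cycle es (p @ [z])"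
          proof (rule path_closes_to_cycle)
            show "successively (\<lambda>a b. {a, b} \<in> set es) p"
              using p(6) by (rule successively_mono) auto
            show "{last p, z} \<in> set es" using p(3) y' e by (simp add: insert_commute)
            show "{z, hd p} \<in> set es" using p(2) yz(3) by (simp add: insert_commute)
          qed (use p yz(2) len in auto)
          with acyc show False by blast
        qed
        thus ?thesis using y' by simp
      qed
    qed
    hence "grown_tree (insert z U) {e \<in> set es. e \<subseteq> insert z U}"
      using grown_tree.leaf[OF tree yz(1,2)] by simp
    moreover have "z \<in> set vs" using simple[OF yz(3)] by auto
    ultimately have "insert z U \<in> \<U>" using Uvs by (auto simp: \<U>_def)
    from max[OF this] yz(2) show False by auto
  qed
  moreover have "{e \<in> set es. e \<subseteq> set vs} = set es" using simple by auto
  ultimately show ?thesis using tree by simp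
qed

section \<open>Entropy\<close>

text \<open>
  Since the squared singular values add up to \<open>2 m\<close>, the entropy depends on \<open>m\<close> and \<open>S\<close> only. For
  \<open>m = 0\<close> all singular values and, by \<open>x / 0 = 0\<close>, all summands vanish.
\<close>

lemma graph_entropy_spectrum:
  fixes vs :: "'a list" and es :: "'a set list" and q :: "nat \<Rightarrow> real"
  assumes q: "\<And>i. 0 \<le> q i"
    and ev: "incidence_eigenvalues vs es = image_mset q (mset_set {..<n})"
    and tr: "(\<Sum>i<n. q i) = 2 * real m"
  defines "S \<equiv> \<Sum>i<n. sqrt (q i)"
  shows "sum_mset (incidence_singular_values vs es) = S"
    and "(\<Sum>s\<in>#incidence_singular_values vs es. s * (S - s)) = S\<^sup>2 - 2 * real m"
    and "m = 0 \<longleftrightarrow> S = 0"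
    and "graph_entropy vs es = (if m = 0 then 0 else 1 - 2 * real m / S\<^sup>2)"
proof -
  have sv: "incidence_singular_values vs es = image_mset (\<lambda>i. sqrt (q i)) (mset_set {..<n})"
    by (simp add: incidence_singular_values_def ev multiset.map_comp comp_def)
  have sum_sv: "(\<Sum>s\<in>#incidence_singular_values vs es. f s) = (\<Sum>i<n. f (sqrt (q i)))"
    for f :: "real \<Rightarrow> real"
    by (simp add: sv multiset.map_comp comp_def sum_unfold_sum_mset)
  show S: "sum_mset (incidence_singular_values vs es) = S"
    using sum_sv[of "\<lambda>s. s"] by (simp add: S_def)
  have sq: "(\<Sum>i<n. (sqrt (q i))\<^sup>2) = 2 * real m" using q tr by simp
  have conc: "(\<Sum>i<n. sqrt (q i) * (S - sqrt (q i))) = S\<^sup>2 - 2 * real m"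
  proof -
    have "(\<Sum>i<n. sqrt (q i) * (S - sqrt (q i))) = (\<Sum>i<n. sqrt (q i) * S - (sqrt (q i))\<^sup>2)"
      by (intro sum.cong refl) (simp only: right_diff_distrib power2_eq_square)
    also have "\<dots> = S * S - 2 * real m"
      unfolding sum_subtractf sq S_def sum_distrib_right ..
    finally show ?thesis by (simp add: power2_eq_square)
  qed
  show "(\<Sum>s\<in>#incidence_singular_values vs es. s * (S - s)) = S\<^sup>2 - 2 * real m"
    unfolding sum_sv by (rule conc)
  have S0: "S = 0 \<longleftrightarrow> (\<forall>i<n. q i = 0)"
    unfolding S_def using q by (subst sum_nonneg_eq_0_iff) auto
  have m0: "m = 0 \<longleftrightarrow> (\<forall>i<n. q i = 0)"
  proof -
    have "m = 0 \<longleftrightarrow> (\<Sum>i<n. q i) = 0" by (simp add: tr)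
    also have "\<dots> \<longleftrightarrow> (\<forall>i<n. q i = 0)" using q by (subst sum_nonneg_eq_0_iff) auto
    finally show ?thesis .
  qed
  show mS: "m = 0 \<longleftrightarrow> S = 0" using S0 m0 by simp
  have "graph_entropy vs es = (\<Sum>i<n. sqrt (q i) / S * (1 - sqrt (q i) / S))"
    by (simp only: graph_entropy_def Let_def S sum_sv)
  also have "\<dots> = (if m = 0 then 0 else 1 - 2 * real m / S\<^sup>2)"
  proof (cases "m = 0")
    case False
    hence "S \<noteq> 0" using mS by simp
    hence "x / S * (1 - x / S) = x * (S - x) / S\<^sup>2" for x
      by (simp add: power2_eq_square diff_divide_distrib right_diff_distrib)
    hence "(\<Sum>i<n. sqrt (q i) / S * (1 - sqrt (q i) / S)) =
        (\<Sum>i<n. sqrt (q i) * (S - sqrt (q i))) / S\<^sup>2"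
      by (simp only: sum_divide_distrib)
    also have "\<dots> = 1 - 2 * real m / S\<^sup>2"
      unfolding conc using \<open>S \<noteq> 0\<close> by (simp add: diff_divide_distrib)
    finally show ?thesis using False by simp
  qed (use mS in simp)
  finally show "graph_entropy vs es = (if m = 0 then 0 else 1 - 2 * real m / S\<^sup>2)" .
qed

text \<open>
  The bounds amount to \<open>2 m \<le> S\<^sup>2 \<le> 2 m n\<close>. The left equality is the concentration of the spectrum on
  one eigenvalue, the right one its equidistribution.
\<close>

lemma graph_entropy_bounds:
  fixes vs :: "'a list" and es :: "'a set list"
  assumes G: "simple_graph vs es" and n: "n = length vs" "1 \<le> n" and m: "m = length es"
  defines "\<sigma> \<equiv> incidence_singular_values vs es"
  shows "0 \<le> graph_entropy vs es" "graph_entropy vs es \<le> 1 - 1 / real n"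
    and "graph_entropy vs es = 0 \<longleftrightarrow> m \<le> 1"
    and "0 < m \<Longrightarrow> graph_entropy vs es \<noteq> 1 - 1 / real n"
    and "(\<Sum>s\<in>#\<sigma>. s * (sum_mset \<sigma> - s)) = (1 - 1 / real n) * (sum_mset \<sigma>)\<^sup>2 \<longleftrightarrow> m = 0"
proof -
  obtain q :: "nat \<Rightarrow> real" where q: "\<And>i. 0 \<le> q i"
    and ev: "incidence_eigenvalues vs es = image_mset q (mset_set {..<n})"
    and tr: "(\<Sum>i<n. q i) = 2 * real m"
    and conc: "(\<Sum>i<n. q i)\<^sup>2 = (\<Sum>i<n. (q i)\<^sup>2) \<longleftrightarrow> m \<le> 1"
    and spread: "0 < m \<Longrightarrow> (\<Sum>i<n. q i)\<^sup>2 < real n * (\<Sum>i<n. (q i)\<^sup>2)"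
  proof (rule graph_spectrum[OF G, folded n(1) m])
    fix q :: "nat \<Rightarrow> real"
    assume a: "\<And>i. 0 \<le> q i" "incidence_eigenvalues vs es = image_mset q (mset_set {..<n})"
      "(\<Sum>i<n. q i) = 2 * real m" "(\<Sum>i<n. q i)\<^sup>2 = (\<Sum>i<n. (q i)\<^sup>2) \<longleftrightarrow> m \<le> 1"
      "0 < m \<Longrightarrow> (\<Sum>i<n. q i)\<^sup>2 < real n * (\<Sum>i<n. (q i)\<^sup>2)"
    show thesis by (rule that[of q]; fact a)
  qed
  define S where "S = (\<Sum>i<n. sqrt (q i))"
  note spec = graph_entropy_spectrum[OF q ev tr, folded S_def]
  have n0: "0 < real n" using n(2) by simp
  have S_sq: "S\<^sup>2 = 2 * real m \<longleftrightarrow> m \<le> 1"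
    using sum_square_eq_iff_sum_sqrt_square_eq[of "{..<n}" q] q conc by (simp add: S_def tr)
  have lower: "2 * real m \<le> S\<^sup>2"
  proof -
    have "(\<Sum>i<n. sqrt (q i) * sqrt (q i)) \<le> (\<Sum>i<n. sqrt (q i) * S)"
      unfolding S_def using q by (intro sum_mono mult_left_mono member_le_sum) auto
    also have "\<dots> = S\<^sup>2" by (simp add: S_def power2_eq_square sum_distrib_right)
    finally show ?thesis using q tr by simp
  qed
  have upper: "S\<^sup>2 \<le> 2 * real m * real n"
    using sum_squared_le_sum_of_squares[of "\<lambda>i. sqrt (q i)" "{..<n}"] q tr by (simp add: S_def)
  \<comment> \<open>Equality would force equal singular values, and so equal eigenvalues.\<close>
  have upper_strict: "S\<^sup>2 \<noteq> 2 * real m * real n" if "0 < m"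
  proof
    assume "S\<^sup>2 = 2 * real m * real n"
    hence "real (card {..<n}) * (\<Sum>i<n. (sqrt (q i))\<^sup>2) = (\<Sum>i<n. sqrt (q i))\<^sup>2"
      using q tr by (simp add: S_def mult.commute)
    hence eq: "sqrt (q i) = S / n" if "i < n" for i
      using equal_of_card_sum_squares[of "{..<n}" "\<lambda>i. sqrt (q i)" i] that by (simp add: S_def)
    define c where "c = (S / n)\<^sup>2"
    have "q i = c" if "i < n" for i
      using eq[OF that] q[of i] unfolding c_def by (metis real_sqrt_pow2)
    hence "(\<Sum>i<n. q i)\<^sup>2 = real n * (\<Sum>i<n. (q i)\<^sup>2)"
      by (simp add: power2_eq_square)
    with spread[OF that] show False by simp
  qed
  have pos: "0 < S\<^sup>2" if "0 < m" using spec(3) that by simp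
  show "0 \<le> graph_entropy vs es"
  proof (cases "m = 0")
    case False
    thus ?thesis using spec(4) lower pos by simp
  qed (simp add: spec(4))
  show "graph_entropy vs es \<le> 1 - 1 / real n"
  proof (cases "m = 0")
    case True
    thus ?thesis using spec(4) n(2) by simp
  next
    case False
    have "1 / real n \<le> 2 * real m / S\<^sup>2"
      using upper pos n0 False by (simp add: field_simps)
    thus ?thesis using spec(4) False by simp
  qed
  show "graph_entropy vs es = 0 \<longleftrightarrow> m \<le> 1"
  proof (cases "m = 0")
    case False
    have "1 - 2 * real m / S\<^sup>2 = 0 \<longleftrightarrow> S\<^sup>2 = 2 * real m"
      using pos False by (auto simp: field_simps)
    hence "graph_entropy vs es = 0 \<longleftrightarrow> S\<^sup>2 = 2 * real m"
      using spec(4) False by simp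
    thus ?thesis using S_sq by simp
  qed (simp add: spec(4))
  show "graph_entropy vs es \<noteq> 1 - 1 / real n" if "0 < m"
  proof -
    have "2 * real m / S\<^sup>2 \<noteq> 1 / real n"
      using upper_strict[OF that] pos[OF that] n0 by (auto simp: field_simps)
    thus ?thesis using spec(4) that by simp
  qed
  show "(\<Sum>s\<in>#\<sigma>. s * (sum_mset \<sigma> - s)) = (1 - 1 / real n) * (sum_mset \<sigma>)\<^sup>2 \<longleftrightarrow> m = 0"
  proof -
    have "S\<^sup>2 - 2 * real m = (1 - 1 / real n) * S\<^sup>2 \<longleftrightarrow> S\<^sup>2 = 2 * real m * real n"
      using n0 by (auto simp: field_simps)
    also have "\<dots> \<longleftrightarrow> m = 0" using upper_strict spec(3) by auto
    finally show ?thesis unfolding \<sigma>_def spec(1,2) .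
  qed
qed

lemma graph_spectrum_matching:
  fixes vs :: "'a list" and es :: "'a set list"
  assumes G: "simple_graph vs es"
  obtains q :: "nat \<Rightarrow> real" where
    "\<And>i. 0 \<le> q i"
    "incidence_eigenvalues vs es = image_mset q (mset_set {..<length vs})"
    "(\<Sum>i<length vs. q i) = 2 * real (length es)"
    "\<And>t. 0 < t \<Longrightarrow>
      (\<Prod>i<length vs. 1 + t * q i) = matching_sum t (subdivision (set vs) (set es))"
proof (rule graph_spectrum[OF G])
  fix q :: "nat \<Rightarrow> real"
  assume q: "\<And>i. 0 \<le> q i"
    "incidence_eigenvalues vs es = image_mset q (mset_set {..<length vs})"
    "(\<Sum>i<length vs. q i) = 2 * real (length es)"
    and det: "\<And>t. 0 < t \<Longrightarrow> (\<Prod>i<length vs. 1 + t * q i) =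
      det (1\<^sub>m (length vs) + t \<cdot>\<^sub>m (incidence_mat vs es * transpose_mat (incidence_mat vs es)))"
  have "distinct vs" "distinct es" using G by (auto simp: simple_graph_def)
  note gram = det_gram_matching_sum[OF this, folded subdivision_def]
  show thesis
    by (rule that[of q]; (fact q | simp only: det gram))
qed

text \<open>
  For equal numbers of vertices and edges the entropy increases with \<open>S\<close>.
\<close>

lemma graph_entropy_le_of_matching_le:
  fixes vs :: "'a list" and es :: "'a set list" and us :: "'b list" and fs :: "'b set list"
  assumes G: "simple_graph vs es" and H: "simple_graph us fs"
    and len: "length vs = length us" "length es = length fs"
    and le: "\<And>t. 0 < t \<Longrightarrow> matching_sum t (subdivision (set vs) (set es)) \<le>
      matching_sum t (subdivision (set us) (set fs))"
  shows "graph_entropy vs es \<le> graph_entropy us fs"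
proof -
  define n where "n = length vs"
  define m where "m = length es"
  obtain p :: "nat \<Rightarrow> real" where p: "\<And>i. 0 \<le> p i"
    "incidence_eigenvalues vs es = image_mset p (mset_set {..<n})" "(\<Sum>i<n. p i) = 2 * real m"
    "\<And>t. 0 < t \<Longrightarrow> (\<Prod>i<n. 1 + t * p i) = matching_sum t (subdivision (set vs) (set es))"
    using graph_spectrum_matching[OF G, folded n_def m_def] by blast
  obtain q :: "nat \<Rightarrow> real" where q: "\<And>i. 0 \<le> q i"
    "incidence_eigenvalues us fs = image_mset q (mset_set {..<n})" "(\<Sum>i<n. q i) = 2 * real m"
    "\<And>t. 0 < t \<Longrightarrow> (\<Prod>i<n. 1 + t * q i) = matching_sum t (subdivision (set us) (set fs))"
    using graph_spectrum_matching[OF H, folded len, folded n_def m_def] by blast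
  define P where "P = (\<Sum>i<n. sqrt (p i))"
  define S where "S = (\<Sum>i<n. sqrt (q i))"
  note spec_p = graph_entropy_spectrum[OF p(1-3), folded P_def]
  note spec_q = graph_entropy_spectrum[OF q(1-3), folded S_def]
  have PS: "P \<le> S"
    unfolding P_def S_def by (rule sum_sqrt_mono_of_prod_le) (use p q le in auto)
  have P0: "0 \<le> P" using p(1) by (auto simp: P_def intro: sum_nonneg)
  show ?thesis
  proof (cases "m = 0")
    case True
    thus ?thesis using spec_p(4) spec_q(4) by simp
  next
    case False
    hence "0 < P\<^sup>2" "P\<^sup>2 \<le> S\<^sup>2" using spec_p(3) P0 PS by (auto intro: power_mono)
    hence "2 * real m / S\<^sup>2 \<le> 2 * real m / P\<^sup>2"
      by (intro divide_left_mono mult_pos_pos) linarith+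
    thus ?thesis using spec_p(4) spec_q(4) False by simp
  qed
qed

lemma simple_graph_star: "simple_graph [0..<n] (star_edges n)"
  by (auto simp: simple_graph_def star_edges_def distinct_map inj_on_def doubleton_eq_iff)

lemma simple_graph_path: "simple_graph [0..<n] (path_edges n)"
  by (auto simp: simple_graph_def path_edges_def distinct_map inj_on_def doubleton_eq_iff)

lemma tree_entropy_between:
  fixes vs :: "'a list" and es :: "'a set list"
  assumes T: "is_tree vs es" and n: "n = length vs"
  shows "graph_entropy [0..<n] (star_edges n) \<le> graph_entropy vs es"
    and "graph_entropy vs es \<le> graph_entropy [0..<n] (path_edges n)"
proof -
  have G: "simple_graph vs es" and ne: "vs \<noteq> []" using T by (auto simp: is_tree_def)
  have tree: "grown_tree (set vs) (set es)" by (rule is_tree_imp_grown_tree[OF T])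
  define k where "k = length es"
  have card: "card (set vs) = n" "card (set es) = k"
    using G n by (auto simp: simple_graph_def k_def distinct_card)
  hence nk: "n = Suc k" using grown_tree_basic[OF tree] by simp
  have "length (star_edges n) = n - 1" "length (path_edges n) = n - 1"
    by (simp_all add: star_edges_def path_edges_def)
  hence len: "length [0..<n] = length vs" "length (star_edges n) = length es"
    "length (path_edges n) = length es"
    using nk n by (simp_all add: k_def)
  show "graph_entropy [0..<n] (star_edges n) \<le> graph_entropy vs es"
  proof (rule graph_entropy_le_of_matching_le[OF simple_graph_star G len(1,2)])
    fix t :: real assume "0 < t"
    thus "matching_sum t (subdivision (set [0..<n]) (set (star_edges n))) \<le>
        matching_sum t (subdivision (set vs) (set es))"
      using star_le_grown_tree_matching[OF tree, of t] matching_sum_star_edges[of t k]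
      unfolding set_upt nk card(2) by simp
  qed
  show "graph_entropy vs es \<le> graph_entropy [0..<n] (path_edges n)"
  proof (rule graph_entropy_le_of_matching_le[OF G simple_graph_path len(1,3)[symmetric]])
    fix t :: real assume "0 < t"
    thus "matching_sum t (subdivision (set vs) (set es)) \<le>
        matching_sum t (subdivision (set [0..<n]) (set (path_edges n)))"
      using grown_tree_matching_le_path[OF tree, of t] matching_sum_path_edges[of t k]
      unfolding set_upt nk card(2) by simp
  qed
qed

theorem corollary3p6:
  shows
    "(\<forall>(vs :: 'a list) (es :: 'a set list) n m.
        simple_graph vs es \<and> n = length vs \<and> m = length es \<and> 1 \<le> n \<longrightarrow>
          0 \<le> graph_entropy vs es \<and>
          graph_entropy vs es \<le> 1 - 1 / real n \<and>
          (graph_entropy vs es = 0 \<longleftrightarrow> m \<le> 1) \<and>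
          (0 < m \<or> n = 1 \<longrightarrow> (graph_entropy vs es = 1 - 1 / real n \<longleftrightarrow> m = 0)) \<and>
          (let \<sigma> = incidence_singular_values vs es; S = sum_mset \<sigma> in
             (\<Sum>s\<in>#\<sigma>. s * (S - s)) = (1 - 1 / real n) * S\<^sup>2 \<longleftrightarrow> m = 0))
     \<and>
     (\<forall>(vs :: 'b list) (es :: 'b set list) n.
        is_tree vs es \<and> n = length vs \<longrightarrow>
          graph_entropy [0..<n] (star_edges n) \<le> graph_entropy vs es \<and>
          graph_entropy vs es \<le> graph_entropy [0..<n] (path_edges n))"
proof (intro conjI allI impI)
  fix vs :: "'a list" and es :: "'a set list" and n m
  assume "simple_graph vs es \<and> n = length vs \<and> m = length es \<and> 1 \<le> n"
  hence G: "simple_graph vs es" "n = length vs" "1 \<le> n" "m = length es" by auto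
  note bounds = graph_entropy_bounds[OF G]
  show "0 \<le> graph_entropy vs es" "graph_entropy vs es \<le> 1 - 1 / real n"
    "graph_entropy vs es = 0 \<longleftrightarrow> m \<le> 1"
    by (rule bounds)+
  show "graph_entropy vs es = 1 - 1 / real n \<longleftrightarrow> m = 0" if "0 < m \<or> n = 1"
    using that bounds(3,4) by auto
  show "let \<sigma> = incidence_singular_values vs es; S = sum_mset \<sigma> in
      (\<Sum>s\<in>#\<sigma>. s * (S - s)) = (1 - 1 / real n) * S\<^sup>2 \<longleftrightarrow> m = 0"
    unfolding Let_def by (rule bounds(5))
next
  fix vs :: "'b list" and es :: "'b set list" and n
  assume "is_tree vs es \<and> n = length vs"
  thus "graph_entropy [0..<n] (star_edges n) \<le> graph_entropy vs es"
    "graph_entropy vs es \<le> graph_entropy [0..<n] (path_edges n)"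
    using tree_entropy_between by blast+
qed

end
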